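(* Let $\mathcal{C}$ be a fully triangulated category. For $i=1,2$ let $G_i=(f_i,g_i,h_i)$ be a morphism of $2$-triangles from $a_i\xrightarrow{u_i}b_i\xrightarrow{v_i}c_i\xrightarrow{w_i}a_i[1]$ to $a_i'\xrightarrow{u_i'}b_i'\xrightarrow{v_i'}c_i'\xrightarrow{w_i'}a_i'[1]$. Let $G_1\oplus G_2=(f_1\oplus f_2,\,g_1\oplus g_2,\,h_1\oplus h_2)$ be the direct sum morphism from the $2$-triangle $(u_1\oplus u_2,v_1\oplus v_2,w_1\oplus w_2)$ to the $2$-triangle $(u_1'\oplus u_2',v_1'\oplus v_2',w_1'\oplus w_2')$. Then $G_1$ and $G_2$ are both distinguished if and only if $G_1\oplus G_2$ is distinguished.
   Context: Setting. $\mathcal{C}$ is an additive category with an additive automorphism $[1]$. For $n\ge 1$, an $n$-triangle (or $R_n$-diagram) $A$ in $\mathcal{C}$ consists of objects $a_{i,j}$ ($0\le i<j\le n$) and, for all $0\le i<j<k\le n$, morphisms (edges) (i) $a_{i,j}\to a_{i,k}$, (ii) $a_{i,k}\to a_{j,k}$, (iii) $a_{j,k}\to a_{i,j}[1]$ ("degree-one edges"), such that: (S) for each index $m$, the edges among $a_{m,m+1},\dots,a_{m,n},a_{0,m}[1],\dots,a_{m-1,m}[1]$ (shifted where needed) form a commuting diagram, so that each edge is the composite of consecutive ones; (Q) for $i<j<k<l$ the squares $a_{i,k}\to a_{i,l}\to a_{j,l}$ $=$ $a_{i,k}\to a_{j,k}\to a_{j,l}$ and $a_{j,l}\to a_{k,l}\to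 a_{i,k}[1]$ $=$ $a_{j,l}\to a_{i,j}[1]\to a_{i,k}[1]$ commute. A morphism of $n$-triangles is a family of morphisms between corresponding objects commuting with all edges (with $[1]$ applied where appropriate); this gives a category $\Pi_n$. A $2$-triangle is a diagram $a\xrightarrow{u}b\xrightarrow{v}c\xrightarrow{w}a[1]$ ($a=a_{0,1}$, $b=a_{0,2}$, $c=a_{1,2}$), written $(u,v,w)$, and a morphism $(f,g,h):(u,v,w)\to(u',v',w')$ satisfies $gu=u'f$, $hv=v'g$, $f[1]w=w'h$. Faces and degeneracies. For $0\le m\le n$ the face functor $F_m:\Pi_n\to\Pi_{n-1}$ discards all objects having $m$ as an index (and relabels the remaining indices in order). The degeneracy functor $\Pi_{n-1}\to\Pi_n$ repeats index $m$: with $s:\{0,\dots,n\}\to\{0,\dots,n-1\}$ the monotone surjection hitting $m$ twice, the new object at $(i,j)$ is $a_{s(i),s(j)}$ if $s(i)\ne s(j)$ and $0$ otherwise, with the evident edges (original edges, identities or zeros). Base. An $(n-1)$-simplex diagram is a commuting diagram on a chain $x_1\to x_2\to\cdots\to x_n$; the base of $A$ is $a_{0,1}\to a_{0,2}\to\cdots\to a_{0,n}$. Rotations. $\tau(A)$ has objects $\tau(A)_{0,j}=a_{j-1,n}$ and $\tau(A)_{i,j}=a_{i-1,j-1}[1]$ for $1\le i<j$, with the corresponding (shifted) edges of $A$ but with all degree-one edges of $\tau(A)$ multiplied by $-1$ (for $n=2$: $b\xrightarrow{v}c\xrightarrow{w}a[1]\xrightarrow{-u[1]}b[1]$). $\sigma(A)$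 has objects $a_{i,j}[1]$, shifted edges, with degree-one edges multiplied by $-1$. $\mathcal{C}$ is fully triangulated if for each $n\ge2$ there is given a subcategory $D_n\subset\Pi_n$, whose objects are called distinguished $n$-triangles and whose morphisms are called distinguished morphisms (maps), such that for all $n\geq 2$: (1) Isomorphism: any isomorphism between objects of $D_n$ is distinguished, and any object of $\Pi_n$ isomorphic to a distinguished $n$-triangle is distinguished. (2) Rotation: if $A\in D_n$ then $\tau(A),\sigma(A)\in D_n$. (3) Faces: for $n>2$, face functors send distinguished maps of $n$-triangles to distinguished maps of $(n-1)$-triangles, and degeneracy functors send distinguished maps of $(n-1)$-triangles to distinguished maps of $n$-triangles. (4) Bases: every $(n-1)$-simplex diagram is the base of some distinguished $n$-triangle, and every map of $(n-1)$-simplex diagrams $\Sigma\to\Sigma'$ extends to a distinguished map between any given distinguished $n$-triangles with bases $\Sigma,\Sigma'$. (5) Lightning strike: if $(f,g,h)$ and $(f,g,h')$ are distinguished maps between the same two distinguished $2$-triangles $(u,v,w)$ and $(u',v',w')$, then $h'-h=v'\theta w$ for some $\theta:a[1]\to b'$. In particular a distinguished morphism has distinguished source and target. *)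

theory Defs
  imports "HOL-Algebra.Group"
begin

section \<open>Categories\<close>

record ('o, 'm) category =
  Obj :: "'o set"
  Arr :: "'m set"
  Dom :: "'m \<Rightarrow> 'o"
  Cod :: "'m \<Rightarrow> 'o"
  Ident :: "'o \<Rightarrow> 'm"
  Comp :: "'m \<Rightarrow> 'm \<Rightarrow> 'm"  (infixl "\<cdot>\<index>" 70)

definition Hom :: "('o, 'm, 'x) category_scheme \<Rightarrow> 'o \<Rightarrow> 'o \<Rightarrow> 'm set" where
  "Hom C a b = {f \<in> Arr C. Dom C f = a \<and> Cod C f = b}"

locale category =
  fixes C :: "('o, 'm, 'x) category_scheme" (structure)
  assumes Dom_Obj: "f \<in> Arr C \<Longrightarrow> Dom C f \<in> Obj C"
    and Cod_Obj: "f \<in> Arr C \<Longrightarrow> Cod C f \<in> Obj C"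
    and Ident_Hom: "a \<in> Obj C \<Longrightarrow> Ident C a \<in> Hom C a a"
    and Comp_Hom: "\<lbrakk>f \<in> Hom C a b; g \<in> Hom C b c\<rbrakk> \<Longrightarrow> g \<cdot> f \<in> Hom C a c"
    and Comp_Ident_right: "f \<in> Hom C a b \<Longrightarrow> f \<cdot> Ident C a = f"
    and Comp_Ident_left: "f \<in> Hom C a b \<Longrightarrow> Ident C b \<cdot> f = f"
    and Comp_assoc: "\<lbrakk>f \<in> Hom C a b; g \<in> Hom C b c; h \<in> Hom C c d\<rbrakk>
                       \<Longrightarrow> (h \<cdot> g) \<cdot> f = h \<cdot> (g \<cdot> f)"

definition is_iso :: "('o, 'm, 'x) category_scheme \<Rightarrow> 'm \<Rightarrow> bool" where
  "is_iso C f \<longleftrightarrow> f \<in> Arr C \<and>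
     (\<exists>g \<in> Hom C (Cod C f) (Dom C f).
        g \<cdot>\<^bsub>C\<^esub> f = Ident C (Dom C f) \<and> f \<cdot>\<^bsub>C\<^esub> g = Ident C (Cod C f))"

definition is_subcategory ::
  "('o, 'm, 'x) category_scheme \<Rightarrow> 'o set \<Rightarrow> 'm set \<Rightarrow> bool" where
  "is_subcategory C X M \<longleftrightarrow>
     X \<subseteq> Obj C \<and> M \<subseteq> Arr C \<and>
     (\<forall>f\<in>M. Dom C f \<in> X \<and> Cod C f \<in> X) \<and>
     (\<forall>a\<in>X. Ident C a \<in> M) \<and>
     (\<forall>f\<in>M. \<forall>g\<in>M. Cod C f = Dom C g \<longrightarrow> g \<cdot>\<^bsub>C\<^esub> f \<in> M)"


section \<open>Additive categories with an additive automorphism\<close>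

text \<open>\<open>Zero C a b\<close> is the zero arrow from \<open>a\<close> to \<open>b\<close>, \<open>ZeroOb C\<close> a chosen zero object;
  \<open>ShObj\<close> and \<open>ShArr\<close> are the action of \<open>[1]\<close> on objects and arrows.\<close>

record ('o, 'm) shift_category = "('o, 'm) category" +
  Add :: "'m \<Rightarrow> 'm \<Rightarrow> 'm"  (infixl "\<boxplus>\<index>" 65)
  Zero :: "'o \<Rightarrow> 'o \<Rightarrow> 'm"
  ZeroOb :: "'o"
  ShObj :: "'o \<Rightarrow> 'o"
  ShArr :: "'m \<Rightarrow> 'm"

definition hom_group ::
  "('o, 'm, 'x) shift_category_scheme \<Rightarrow> 'o \<Rightarrow> 'o \<Rightarrow> 'm monoid" where
  "hom_group C a b = \<lparr>carrier = Hom C a b, mult = Add C, one = Zero C a b\<rparr>"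

definition Neg :: "('o, 'm, 'x) shift_category_scheme \<Rightarrow> 'm \<Rightarrow> 'm" where
  "Neg C f = inv\<^bsub>hom_group C (Dom C f) (Cod C f)\<^esub> f"

record ('o, 'm) biproduct =
  Apex :: "'o"
  Inj1 :: "'m"
  Inj2 :: "'m"
  Prj1 :: "'m"
  Prj2 :: "'m"

definition is_biproduct ::
  "('o, 'm, 'x) shift_category_scheme \<Rightarrow> 'o \<Rightarrow> 'o \<Rightarrow> ('o, 'm) biproduct \<Rightarrow> bool" where
  "is_biproduct C a b P \<longleftrightarrow>
     Apex P \<in> Obj C \<and>
     Inj1 P \<in> Hom C a (Apex P) \<and> Inj2 P \<in> Hom C b (Apex P) \<and>
     Prj1 P \<in> Hom C (Apex P) a \<and> Prj2 P \<in> Hom C (Apex P) b \<and>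
     Prj1 P \<cdot>\<^bsub>C\<^esub> Inj1 P = Ident C a \<and> Prj2 P \<cdot>\<^bsub>C\<^esub> Inj2 P = Ident C b \<and>
     Prj2 P \<cdot>\<^bsub>C\<^esub> Inj1 P = Zero C a b \<and> Prj1 P \<cdot>\<^bsub>C\<^esub> Inj2 P = Zero C b a \<and>
     (Inj1 P \<cdot>\<^bsub>C\<^esub> Prj1 P) \<boxplus>\<^bsub>C\<^esub> (Inj2 P \<cdot>\<^bsub>C\<^esub> Prj2 P) = Ident C (Apex P)"

text \<open>Since \<open>[1]\<close> is additive, it carries a biproduct of \<open>a\<close> and \<open>b\<close> to one of \<open>a[1]\<close> and \<open>b[1]\<close>.\<close>

definition shift_biproduct ::
  "('o, 'm, 'x) shift_category_scheme \<Rightarrow> ('o, 'm) biproduct \<Rightarrow> ('o, 'm) biproduct" where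
  "shift_biproduct C P =
     \<lparr>Apex = ShObj C (Apex P), Inj1 = ShArr C (Inj1 P), Inj2 = ShArr C (Inj2 P),
      Prj1 = ShArr C (Prj1 P), Prj2 = ShArr C (Prj2 P)\<rparr>"

text \<open>The arrow \<open>f\<^sub>1 \<oplus> f\<^sub>2\<close> from the apex of \<open>P\<close> to the apex of \<open>Q\<close>.\<close>

definition dsum_arr ::
  "('o, 'm, 'x) shift_category_scheme \<Rightarrow> ('o, 'm) biproduct \<Rightarrow> ('o, 'm) biproduct
     \<Rightarrow> 'm \<Rightarrow> 'm \<Rightarrow> 'm" where
  "dsum_arr C P Q f1 f2 =
     (Inj1 Q \<cdot>\<^bsub>C\<^esub> f1 \<cdot>\<^bsub>C\<^esub> Prj1 P) \<boxplus>\<^bsub>C\<^esub> (Inj2 Q \<cdot>\<^bsub>C\<^esub> f2 \<cdot>\<^bsub>C\<^esub> Prj2 P)"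

locale additive_shift_category = category C
  for C :: "('o, 'm, 'x) shift_category_scheme" (structure) +
  assumes hom_comm_group: "\<lbrakk>a \<in> Obj C; b \<in> Obj C\<rbrakk> \<Longrightarrow> comm_group (hom_group C a b)"
    and Comp_Add_right: "\<lbrakk>f \<in> Hom C a b; f' \<in> Hom C a b; g \<in> Hom C b c\<rbrakk>
           \<Longrightarrow> g \<cdot> (f \<boxplus> f') = g \<cdot> f \<boxplus> g \<cdot> f'"
    and Comp_Add_left: "\<lbrakk>f \<in> Hom C a b; g \<in> Hom C b c; g' \<in> Hom C b c\<rbrakk>
           \<Longrightarrow> (g \<boxplus> g') \<cdot> f = g \<cdot> f \<boxplus> g' \<cdot> f"
    and ZeroOb_Obj: "ZeroOb C \<in> Obj C"
    and ZeroOb_initial: "a \<in> Obj C \<Longrightarrow> \<exists>!f. f \<in> Hom C (ZeroOb C) a"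
    and ZeroOb_terminal: "a \<in> Obj C \<Longrightarrow> \<exists>!f. f \<in> Hom C a (ZeroOb C)"
    and biproduct_exists: "\<lbrakk>a \<in> Obj C; b \<in> Obj C\<rbrakk> \<Longrightarrow> \<exists>P. is_biproduct C a b P"
    and ShObj_bij: "bij_betw (ShObj C) (Obj C) (Obj C)"
    and ShArr_bij: "bij_betw (ShArr C) (Arr C) (Arr C)"
    and ShArr_Hom: "f \<in> Hom C a b \<Longrightarrow> ShArr C f \<in> Hom C (ShObj C a) (ShObj C b)"
    and ShArr_Ident: "a \<in> Obj C \<Longrightarrow> ShArr C (Ident C a) = Ident C (ShObj C a)"
    and ShArr_Comp: "\<lbrakk>f \<in> Hom C a b; g \<in> Hom C b c\<rbrakk>
           \<Longrightarrow> ShArr C (g \<cdot> f) = ShArr C g \<cdot> ShArr C f"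
    and ShArr_Add: "\<lbrakk>f \<in> Hom C a b; g \<in> Hom C a b\<rbrakk>
           \<Longrightarrow> ShArr C (f \<boxplus> g) = ShArr C f \<boxplus> ShArr C g"


section \<open>The category of n-triangles\<close>

text \<open>For \<open>i < j < k \<le> n\<close> the edges of \<open>A\<close> are
  \<open>E1 A i j k : a\<^sub>i\<^sub>j \<rightarrow> a\<^sub>i\<^sub>k\<close>, \<open>E2 A i j k : a\<^sub>i\<^sub>k \<rightarrow> a\<^sub>j\<^sub>k\<close> and
  \<open>E3 A i j k : a\<^sub>j\<^sub>k \<rightarrow> a\<^sub>i\<^sub>j[1]\<close>, where \<open>a\<^sub>i\<^sub>j = Vx A i j\<close>.\<close>

record ('o, 'm) triangle =
  Vx :: "nat \<Rightarrow> nat \<Rightarrow> 'o"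
  E1 :: "nat \<Rightarrow> nat \<Rightarrow> nat \<Rightarrow> 'm"
  E2 :: "nat \<Rightarrow> nat \<Rightarrow> nat \<Rightarrow> 'm"
  E3 :: "nat \<Rightarrow> nat \<Rightarrow> nat \<Rightarrow> 'm"

record ('o, 'm) triangle_map =
  Src :: "('o, 'm) triangle"
  Tgt :: "('o, 'm) triangle"
  Cmp :: "nat \<Rightarrow> nat \<Rightarrow> 'm"

text \<open>All families are made \<open>undefined\<close> outside the index range, so that equality of
  n-triangles and of their maps is equality of the data inside the range.\<close>

definition restr2 :: "nat \<Rightarrow> (nat \<Rightarrow> nat \<Rightarrow> 'a) \<Rightarrow> nat \<Rightarrow> nat \<Rightarrow> 'a" where
  "restr2 n x = (\<lambda>i j. if i < j \<and> j \<le> n then x i j else undefined)"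

definition restr3 :: "nat \<Rightarrow> (nat \<Rightarrow> nat \<Rightarrow> nat \<Rightarrow> 'a) \<Rightarrow> nat \<Rightarrow> nat \<Rightarrow> nat \<Rightarrow> 'a" where
  "restr3 n x = (\<lambda>i j k. if i < j \<and> j < k \<and> k \<le> n then x i j k else undefined)"

definition mk_triangle ::
  "nat \<Rightarrow> (nat \<Rightarrow> nat \<Rightarrow> 'o) \<Rightarrow> (nat \<Rightarrow> nat \<Rightarrow> nat \<Rightarrow> 'm) \<Rightarrow> (nat \<Rightarrow> nat \<Rightarrow> nat \<Rightarrow> 'm)
     \<Rightarrow> (nat \<Rightarrow> nat \<Rightarrow> nat \<Rightarrow> 'm) \<Rightarrow> ('o, 'm) triangle" where
  "mk_triangle n x p q r =
     \<lparr>Vx = restr2 n x, E1 = restr3 n p, E2 = restr3 n q, E3 = restr3 n r\<rparr>"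

definition mk_triangle_map ::
  "nat \<Rightarrow> ('o, 'm) triangle \<Rightarrow> ('o, 'm) triangle \<Rightarrow> (nat \<Rightarrow> nat \<Rightarrow> 'm) \<Rightarrow> ('o, 'm) triangle_map"
  where "mk_triangle_map n A B \<phi> = \<lparr>Src = A, Tgt = B, Cmp = restr2 n \<phi>\<rparr>"

text \<open>Condition (S): for fixed \<open>m\<close> the diagram is the chain
  \<open>a\<^sub>m\<^sub>,\<^sub>m\<^sub>+\<^sub>1, \<dots>, a\<^sub>m\<^sub>,\<^sub>n, a\<^sub>0\<^sub>,\<^sub>m[1], \<dots>, a\<^sub>m\<^sub>-\<^sub>1\<^sub>,\<^sub>m[1]\<close>; the four clauses are the
  composable pairs of edges, according to how many of the three objects lie in the shifted part.\<close>

definition lines_commute ::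
  "('o, 'm, 'x) shift_category_scheme \<Rightarrow> nat \<Rightarrow> ('o, 'm) triangle \<Rightarrow> bool" where
  "lines_commute C n A \<longleftrightarrow> (\<forall>m\<le>n.
     (\<forall>j k l. m < j \<and> j < k \<and> k < l \<and> l \<le> n \<longrightarrow>
        E1 A m k l \<cdot>\<^bsub>C\<^esub> E1 A m j k = E1 A m j l) \<and>
     (\<forall>i k l. i < m \<and> m < k \<and> k < l \<and> l \<le> n \<longrightarrow>
        E3 A i m l \<cdot>\<^bsub>C\<^esub> E1 A m k l = E3 A i m k) \<and>
     (\<forall>i j l. i < j \<and> j < m \<and> m < l \<and> l \<le> n \<longrightarrow>
        ShArr C (E2 A i j m) \<cdot>\<^bsub>C\<^esub> E3 A i m l = E3 A j m l) \<and>
     (\<forall>i j k. i < j \<and> j < k \<and> k < m \<longrightarrow>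
        ShArr C (E2 A j k m) \<cdot>\<^bsub>C\<^esub> ShArr C (E2 A i j m) = ShArr C (E2 A i k m)))"

definition squares_commute ::
  "('o, 'm, 'x) shift_category_scheme \<Rightarrow> nat \<Rightarrow> ('o, 'm) triangle \<Rightarrow> bool" where
  "squares_commute C n A \<longleftrightarrow> (\<forall>i j k l. i < j \<and> j < k \<and> k < l \<and> l \<le> n \<longrightarrow>
     E2 A i j l \<cdot>\<^bsub>C\<^esub> E1 A i k l = E1 A j k l \<cdot>\<^bsub>C\<^esub> E2 A i j k \<and>
     E3 A i k l \<cdot>\<^bsub>C\<^esub> E2 A j k l = ShArr C (E1 A i j k) \<cdot>\<^bsub>C\<^esub> E3 A i j l)"

definition is_triangle ::
  "('o, 'm, 'x) shift_category_scheme \<Rightarrow> nat \<Rightarrow> ('o, 'm) triangle \<Rightarrow> bool" where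
  "is_triangle C n A \<longleftrightarrow>
     A = mk_triangle n (Vx A) (E1 A) (E2 A) (E3 A) \<and>
     (\<forall>i j. i < j \<and> j \<le> n \<longrightarrow> Vx A i j \<in> Obj C) \<and>
     (\<forall>i j k. i < j \<and> j < k \<and> k \<le> n \<longrightarrow>
        E1 A i j k \<in> Hom C (Vx A i j) (Vx A i k) \<and>
        E2 A i j k \<in> Hom C (Vx A i k) (Vx A j k) \<and>
        E3 A i j k \<in> Hom C (Vx A j k) (ShObj C (Vx A i j))) \<and>
     lines_commute C n A \<and> squares_commute C n A"

definition is_triangle_map ::
  "('o, 'm, 'x) shift_category_scheme \<Rightarrow> nat \<Rightarrow> ('o, 'm) triangle_map \<Rightarrow> bool" where
  "is_triangle_map C n G \<longleftrightarrow>
     G = mk_triangle_map n (Src G) (Tgt G) (Cmp G) \<and>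
     is_triangle C n (Src G) \<and> is_triangle C n (Tgt G) \<and>
     (\<forall>i j. i < j \<and> j \<le> n \<longrightarrow> Cmp G i j \<in> Hom C (Vx (Src G) i j) (Vx (Tgt G) i j)) \<and>
     (\<forall>i j k. i < j \<and> j < k \<and> k \<le> n \<longrightarrow>
        Cmp G i k \<cdot>\<^bsub>C\<^esub> E1 (Src G) i j k = E1 (Tgt G) i j k \<cdot>\<^bsub>C\<^esub> Cmp G i j \<and>
        Cmp G j k \<cdot>\<^bsub>C\<^esub> E2 (Src G) i j k = E2 (Tgt G) i j k \<cdot>\<^bsub>C\<^esub> Cmp G i k \<and>
        ShArr C (Cmp G i j) \<cdot>\<^bsub>C\<^esub> E3 (Src G) i j k = E3 (Tgt G) i j k \<cdot>\<^bsub>C\<^esub> Cmp G j k)"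

definition triangle_category ::
  "('o, 'm, 'x) shift_category_scheme \<Rightarrow> nat
     \<Rightarrow> (('o, 'm) triangle, ('o, 'm) triangle_map) category" where
  "triangle_category C n =
     \<lparr>Obj = {A. is_triangle C n A},
      Arr = {G. is_triangle_map C n G},
      Dom = Src,
      Cod = Tgt,
      Ident = (\<lambda>A. mk_triangle_map n A A (\<lambda>i j. Ident C (Vx A i j))),
      Comp = (\<lambda>H G. mk_triangle_map n (Src G) (Tgt H) (\<lambda>i j. Cmp H i j \<cdot>\<^bsub>C\<^esub> Cmp G i j))\<rparr>"

text \<open>The 2-triangle \<open>(u, v, w)\<close> on \<open>a = a\<^sub>0\<^sub>1\<close>, \<open>b = a\<^sub>0\<^sub>2\<close>, \<open>c = a\<^sub>1\<^sub>2\<close>, and the family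
  \<open>(f, g, h)\<close> between two 2-triangles.\<close>

definition triangle2 ::
  "'o \<Rightarrow> 'o \<Rightarrow> 'o \<Rightarrow> 'm \<Rightarrow> 'm \<Rightarrow> 'm \<Rightarrow> ('o, 'm) triangle" where
  "triangle2 a b c u v w =
     mk_triangle 2 (\<lambda>i j. if i = 1 then c else if j = 1 then a else b)
       (\<lambda>_ _ _. u) (\<lambda>_ _ _. v) (\<lambda>_ _ _. w)"

definition triangle2_map ::
  "('o, 'm) triangle \<Rightarrow> ('o, 'm) triangle \<Rightarrow> 'm \<Rightarrow> 'm \<Rightarrow> 'm \<Rightarrow> ('o, 'm) triangle_map" where
  "triangle2_map A B f g h =
     mk_triangle_map 2 A B (\<lambda>i j. if i = 1 then h else if j = 1 then f else g)"


section \<open>Faces, degeneracies, rotations and bases\<close>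

definition skip :: "nat \<Rightarrow> nat \<Rightarrow> nat" where
  "skip m i = (if i < m then i else Suc i)"

definition hit_twice :: "nat \<Rightarrow> nat \<Rightarrow> nat" where
  "hit_twice m i = (if i \<le> m then i else i - 1)"

text \<open>\<open>face n m\<close> and \<open>face_map n m\<close> go from n-triangles to (n-1)-triangles, for \<open>m \<le> n\<close>.\<close>

definition face :: "nat \<Rightarrow> nat \<Rightarrow> ('o, 'm) triangle \<Rightarrow> ('o, 'm) triangle" where
  "face n m A = (let d = skip m in
     mk_triangle (n - 1) (\<lambda>i j. Vx A (d i) (d j))
       (\<lambda>i j k. E1 A (d i) (d j) (d k))
       (\<lambda>i j k. E2 A (d i) (d j) (d k))
       (\<lambda>i j k. E3 A (d i) (d j) (d k)))"

definition face_map :: "nat \<Rightarrow> nat \<Rightarrow> ('o, 'm) triangle_map \<Rightarrow> ('o, 'm) triangle_map" where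
  "face_map n m G =
     mk_triangle_map (n - 1) (face n m (Src G)) (face n m (Tgt G))
       (\<lambda>i j. Cmp G (skip m i) (skip m j))"

text \<open>\<open>degen C n m\<close> and \<open>degen_map C n m\<close> go from (n-1)-triangles to n-triangles, for \<open>m \<le> n - 1\<close>.
  For \<open>i < j < k\<close> at most one of \<open>s i = s j\<close>, \<open>s j = s k\<close> holds; the edges with an end at a
  newly inserted zero object are zero, the remaining new edges are identities.
  The squares of \<open>degen C n m A\<close> through the zero object commute only when the composites of two
  consecutive edges \<open>E1, E2, E3, E1[1]\<close> of \<open>A\<close> vanish; for distinguished \<open>A\<close> this is contained in
  the requirement below that degeneracies of distinguished maps be distinguished.\<close>

definition degen ::
  "('o, 'm, 'x) shift_category_scheme \<Rightarrow> nat \<Rightarrow> nat \<Rightarrow> ('o, 'm) triangle \<Rightarrow> ('o, 'm) triangle" where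
  "degen C n m A = (let s = hit_twice m;
       x = (\<lambda>i j. if s i \<noteq> s j then Vx A (s i) (s j) else ZeroOb C) in
     mk_triangle n x
       (\<lambda>i j k. if s i = s j then Zero C (x i j) (x i k)
                else if s j = s k then Ident C (x i j)
                else E1 A (s i) (s j) (s k))
       (\<lambda>i j k. if s j = s k then Zero C (x i k) (x j k)
                else if s i = s j then Ident C (x i k)
                else E2 A (s i) (s j) (s k))
       (\<lambda>i j k. if s i = s j \<or> s j = s k then Zero C (x j k) (ShObj C (x i j))
                else E3 A (s i) (s j) (s k)))"

definition degen_map ::
  "('o, 'm, 'x) shift_category_scheme \<Rightarrow> nat \<Rightarrow> nat \<Rightarrow> ('o, 'm) triangle_map
     \<Rightarrow> ('o, 'm) triangle_map" where
  "degen_map C n m G = (let s = hit_twice m in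
     mk_triangle_map n (degen C n m (Src G)) (degen C n m (Tgt G))
       (\<lambda>i j. if s i \<noteq> s j then Cmp G (s i) (s j) else Zero C (ZeroOb C) (ZeroOb C)))"

definition tau ::
  "('o, 'm, 'x) shift_category_scheme \<Rightarrow> nat \<Rightarrow> ('o, 'm) triangle \<Rightarrow> ('o, 'm) triangle" where
  "tau C n A =
     mk_triangle n
       (\<lambda>i j. if i = 0 then Vx A (j - 1) n else ShObj C (Vx A (i - 1) (j - 1)))
       (\<lambda>i j k. if i = 0 then E2 A (j - 1) (k - 1) n
                else ShArr C (E1 A (i - 1) (j - 1) (k - 1)))
       (\<lambda>i j k. if i = 0 then E3 A (j - 1) (k - 1) n
                else ShArr C (E2 A (i - 1) (j - 1) (k - 1)))
       (\<lambda>i j k. if i = 0 then Neg C (ShArr C (E1 A (j - 1) (k - 1) n))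
                else Neg C (ShArr C (E3 A (i - 1) (j - 1) (k - 1))))"

definition sigma ::
  "('o, 'm, 'x) shift_category_scheme \<Rightarrow> nat \<Rightarrow> ('o, 'm) triangle \<Rightarrow> ('o, 'm) triangle" where
  "sigma C n A =
     mk_triangle n (\<lambda>i j. ShObj C (Vx A i j))
       (\<lambda>i j k. ShArr C (E1 A i j k))
       (\<lambda>i j k. ShArr C (E2 A i j k))
       (\<lambda>i j k. Neg C (ShArr C (E3 A i j k)))"

text \<open>An (n-1)-simplex diagram has objects \<open>x\<^sub>1, \<dots>, x\<^sub>n\<close> and edges \<open>x\<^sub>j \<rightarrow> x\<^sub>k\<close> for all \<open>j < k\<close>,
  the non-consecutive ones being forced by commutativity.  It is indexed by \<open>1, \<dots>, n\<close> and,
  like n-triangles, \<open>undefined\<close> elsewhere.\<close>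

record ('o, 'm) simplex =
  SVx :: "nat \<Rightarrow> 'o"
  SEdge :: "nat \<Rightarrow> nat \<Rightarrow> 'm"

definition mk_simplex :: "nat \<Rightarrow> (nat \<Rightarrow> 'o) \<Rightarrow> (nat \<Rightarrow> nat \<Rightarrow> 'm) \<Rightarrow> ('o, 'm) simplex" where
  "mk_simplex n x e =
     \<lparr>SVx = (\<lambda>j. if 1 \<le> j \<and> j \<le> n then x j else undefined),
      SEdge = (\<lambda>j k. if 1 \<le> j \<and> j < k \<and> k \<le> n then e j k else undefined)\<rparr>"

definition is_simplex ::
  "('o, 'm, 'x) shift_category_scheme \<Rightarrow> nat \<Rightarrow> ('o, 'm) simplex \<Rightarrow> bool" where
  "is_simplex C n S \<longleftrightarrow>
     S = mk_simplex n (SVx S) (SEdge S) \<and>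
     (\<forall>j. 1 \<le> j \<and> j \<le> n \<longrightarrow> SVx S j \<in> Obj C) \<and>
     (\<forall>j k. 1 \<le> j \<and> j < k \<and> k \<le> n \<longrightarrow> SEdge S j k \<in> Hom C (SVx S j) (SVx S k)) \<and>
     (\<forall>j k l. 1 \<le> j \<and> j < k \<and> k < l \<and> l \<le> n \<longrightarrow>
        SEdge S k l \<cdot>\<^bsub>C\<^esub> SEdge S j k = SEdge S j l)"

definition is_simplex_map ::
  "('o, 'm, 'x) shift_category_scheme \<Rightarrow> nat \<Rightarrow> ('o, 'm) simplex \<Rightarrow> ('o, 'm) simplex
     \<Rightarrow> (nat \<Rightarrow> 'm) \<Rightarrow> bool" where
  "is_simplex_map C n S S' \<phi> \<longleftrightarrow>
     is_simplex C n S \<and> is_simplex C n S' \<and>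
     (\<forall>j. 1 \<le> j \<and> j \<le> n \<longrightarrow> \<phi> j \<in> Hom C (SVx S j) (SVx S' j)) \<and>
     (\<forall>j k. 1 \<le> j \<and> j < k \<and> k \<le> n \<longrightarrow>
        \<phi> k \<cdot>\<^bsub>C\<^esub> SEdge S j k = SEdge S' j k \<cdot>\<^bsub>C\<^esub> \<phi> j)"

definition base :: "nat \<Rightarrow> ('o, 'm) triangle \<Rightarrow> ('o, 'm) simplex" where
  "base n A = mk_simplex n (Vx A 0) (E1 A 0)"


section \<open>Fully triangulated categories\<close>

text \<open>\<open>DObj n\<close> and \<open>DMap n\<close> are the objects and the morphisms of the subcategory \<open>D\<^sub>n\<close>.\<close>

locale fully_triangulated = additive_shift_category C
  for C :: "('o, 'm, 'x) shift_category_scheme" (structure) +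
  fixes DObj :: "nat \<Rightarrow> ('o, 'm) triangle set"
    and DMap :: "nat \<Rightarrow> ('o, 'm) triangle_map set"
  assumes subcategory:
      "n \<ge> 2 \<Longrightarrow> is_subcategory (triangle_category C n) (DObj n) (DMap n)"
    and iso_map:
      "\<lbrakk>n \<ge> 2; is_iso (triangle_category C n) G; Src G \<in> DObj n; Tgt G \<in> DObj n\<rbrakk>
         \<Longrightarrow> G \<in> DMap n"
    and iso_closed:
      "\<lbrakk>n \<ge> 2; is_iso (triangle_category C n) G; Src G \<in> DObj n\<rbrakk> \<Longrightarrow> Tgt G \<in> DObj n"
    and rotation_tau: "\<lbrakk>n \<ge> 2; A \<in> DObj n\<rbrakk> \<Longrightarrow> tau C n A \<in> DObj n"
    and rotation_sigma: "\<lbrakk>n \<ge> 2; A \<in> DObj n\<rbrakk> \<Longrightarrow> sigma C n A \<in> DObj n"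
    and faces: "\<lbrakk>n > 2; m \<le> n; G \<in> DMap n\<rbrakk> \<Longrightarrow> face_map n m G \<in> DMap (n - 1)"
    and degeneracies:
      "\<lbrakk>n > 2; m \<le> n - 1; G \<in> DMap (n - 1)\<rbrakk> \<Longrightarrow> degen_map C n m G \<in> DMap n"
    and base_exists:
      "\<lbrakk>n \<ge> 2; is_simplex C n S\<rbrakk> \<Longrightarrow> \<exists>A \<in> DObj n. base n A = S"
    and base_map_extends:
      "\<lbrakk>n \<ge> 2; A \<in> DObj n; A' \<in> DObj n; is_simplex_map C n (base n A) (base n A') \<phi>\<rbrakk>
         \<Longrightarrow> \<exists>G \<in> DMap n. Src G = A \<and> Tgt G = A' \<and> (\<forall>j. 1 \<le> j \<and> j \<le> n \<longrightarrow> Cmp G 0 j = \<phi> j)"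
    and lightning_strike:
      "\<lbrakk>triangle2 a b c u v w \<in> DObj 2; triangle2 a' b' c' u' v' w' \<in> DObj 2;
        triangle2_map (triangle2 a b c u v w) (triangle2 a' b' c' u' v' w') f g h \<in> DMap 2;
        triangle2_map (triangle2 a b c u v w) (triangle2 a' b' c' u' v' w') f g h' \<in> DMap 2\<rbrakk>
         \<Longrightarrow> \<exists>\<theta> \<in> Hom C (ShObj C a) b'. h' \<boxplus> Neg C h = v' \<cdot> \<theta> \<cdot> w"

end

theory Submission
  imports Defs
begin

text \<open>A morphism of 2-triangles is distinguished if and only if its source and target are, and a direct
  sum of 2-triangles is distinguished if and only if both summands are.  Together these two facts give
  the theorem.

  The first fact comes from the isomorphism axiom.  For a morphism \<open>G : A \<rightarrow> B\<close> of distinguished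
  2-triangles, the shear of \<open>A \<oplus> B\<close> with entry \<open>G\<close> is an automorphism, its inverse being the shear
  with entry \<open>-G\<close>.  So the shear is distinguished as soon as \<open>A \<oplus> B\<close> is, and \<open>G\<close> is recovered from
  it by composing with an injection and a projection, provided that these are distinguished
  (\<open>dsum_distinguished\<close>, \<open>hom_distinguished\<close>).

  The second fact is proved as for triangulated categories, by comparison with a distinguished
  2-triangle \<open>D\<close> on the same base.  For a sum or a summand \<open>A\<close>, extending injections and
  projections from the bases yields morphisms \<open>(1, 1, k) : A \<rightarrow> D\<close> and \<open>(1, 1, p) : D \<rightarrow> A\<close>.  In place
  of the five lemma, their composites \<open>(1, 1, e)\<close> are seen to be invertible because
  \<open>(1 - e)\<^sup>2 = 0\<close> (\<open>unipotent_invertible\<close>).  What makes this work for \<open>A\<close> is that its third edge \<open>w\<close>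
  is a weak cokernel of its second edge \<open>v\<close>, a property that distinguished 2-triangles have and that
  passes to sums and to retracts.\<close>

section \<open>Arrows of a category\<close>

context category begin

lemma Hom_Obj: "f \<in> Hom C a b \<Longrightarrow> a \<in> Obj C" "f \<in> Hom C a b \<Longrightarrow> b \<in> Obj C"
  using Dom_Obj Cod_Obj by (auto simp: Hom_def)

lemma square_inverse:
  assumes f: "f \<in> Hom C a a'" and f': "f' \<in> Hom C a' a"
    and g: "g \<in> Hom C b b'" and g': "g' \<in> Hom C b' b"
    and x: "x \<in> Hom C a b" and y: "y \<in> Hom C a' b'"
    and "f \<cdot> f' = Ident C a'" "g' \<cdot> g = Ident C b" and sq: "g \<cdot> x = y \<cdot> f"
  shows "g' \<cdot> y = x \<cdot> f'"
proof -
  have "g' \<cdot> y = g' \<cdot> (y \<cdot> (f \<cdot> f'))"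
    using assms by (simp add: Comp_Ident_right[OF y])
  also have "\<dots> = g' \<cdot> ((y \<cdot> f) \<cdot> f')"
    using Comp_assoc[OF f' f y] by simp
  also have "\<dots> = g' \<cdot> (g \<cdot> (x \<cdot> f'))"
    using Comp_assoc[OF f' x g] sq by simp
  also have "\<dots> = (g' \<cdot> g) \<cdot> (x \<cdot> f')"
    using Comp_assoc[OF Comp_Hom[OF f' x] g g'] by simp
  finally show ?thesis
    using assms Comp_Ident_left[OF Comp_Hom[OF f' x]] by simp
qed

lemma square_paste:
  assumes f: "f \<in> Hom C a a'" and f': "f' \<in> Hom C a' a''"
    and g: "g \<in> Hom C b b'" and g': "g' \<in> Hom C b' b''"
    and x: "x \<in> Hom C a b" and y: "y \<in> Hom C a' b'" and z: "z \<in> Hom C a'' b''"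
    and 1: "g \<cdot> x = y \<cdot> f" and 2: "g' \<cdot> y = z \<cdot> f'"
  shows "(g' \<cdot> g) \<cdot> x = z \<cdot> (f' \<cdot> f)"
proof -
  have "(g' \<cdot> g) \<cdot> x = g' \<cdot> (y \<cdot> f)" using Comp_assoc[OF x g g'] 1 by simp
  also have "\<dots> = (z \<cdot> f') \<cdot> f" using Comp_assoc[OF f y g'] 2 by simp
  finally show ?thesis using Comp_assoc[OF f f' z] by simp
qed

text \<open>The left inverse \<open>l p\<close> of \<open>k\<close> and its right inverse \<open>p r\<close> must agree.\<close>

lemma invertible_of_composites:
  assumes k: "k \<in> Hom C a b" and p: "p \<in> Hom C b a"
    and l: "l \<in> Hom C a a" and r: "r \<in> Hom C b b"
    and lp: "l \<cdot> (p \<cdot> k) = Ident C a" and rp: "(k \<cdot> p) \<cdot> r = Ident C b"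
  shows "\<exists>k' \<in> Hom C b a. k' \<cdot> k = Ident C a \<and> k \<cdot> k' = Ident C b"
proof -
  have L: "(l \<cdot> p) \<cdot> k = Ident C a" using Comp_assoc[OF k p l] lp by simp
  have R: "k \<cdot> (p \<cdot> r) = Ident C b" using Comp_assoc[OF r p k] rp by simp
  have lp': "l \<cdot> p \<in> Hom C b a" and pr': "p \<cdot> r \<in> Hom C b a" using Comp_Hom p l r by blast+
  have "l \<cdot> p = (l \<cdot> p) \<cdot> (k \<cdot> (p \<cdot> r))" using Comp_Ident_right[OF lp'] R by simp
  also have "\<dots> = ((l \<cdot> p) \<cdot> k) \<cdot> (p \<cdot> r)" using Comp_assoc[OF pr' k lp'] by simp
  also have "\<dots> = p \<cdot> r" using L Comp_Ident_left[OF pr'] by simp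
  finally have "k \<cdot> (l \<cdot> p) = Ident C b" using R by simp
  then show ?thesis using L lp' by blast
qed

end

section \<open>Additive structure and biproducts\<close>

context additive_shift_category begin

lemma hom_group_sel: "carrier (hom_group C a b) = Hom C a b"
  "mult (hom_group C a b) = Add C" "one (hom_group C a b) = Zero C a b"
  by (simp_all add: hom_group_def)

lemma hom_group_group: "a \<in> Obj C \<Longrightarrow> b \<in> Obj C \<Longrightarrow> group (hom_group C a b)"
  using hom_comm_group comm_group.axioms(2) by blast

lemma Add_Hom: "f \<in> Hom C a b \<Longrightarrow> g \<in> Hom C a b \<Longrightarrow> f \<boxplus> g \<in> Hom C a b"
  using hom_group_group[of a b] Hom_Obj
    monoid.m_closed[of "hom_group C a b" f g]
  by (auto simp: hom_group_sel group_def)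

lemma Zero_Hom: "a \<in> Obj C \<Longrightarrow> b \<in> Obj C \<Longrightarrow> Zero C a b \<in> Hom C a b"
  using monoid.one_closed[OF group.is_monoid[OF hom_group_group[of a b]]]
  by (simp add: hom_group_sel)

lemma Neg_Hom: assumes "f \<in> Hom C a b" shows "Neg C f \<in> Hom C a b"
  using group.inv_closed[OF hom_group_group[of a b], of f] Hom_Obj[OF assms] assms
  by (simp add: Neg_def hom_group_sel Hom_def)

lemma Add_assoc:
  assumes "f \<in> Hom C a b" "g \<in> Hom C a b" "h \<in> Hom C a b"
  shows "f \<boxplus> g \<boxplus> h = f \<boxplus> (g \<boxplus> h)"
  using monoid.m_assoc[OF group.is_monoid[OF hom_group_group[of a b]], of f g h]
    Hom_Obj[OF assms(1)] assms
  by (simp add: hom_group_sel)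

lemma Add_commute:
  assumes "f \<in> Hom C a b" "g \<in> Hom C a b"
  shows "f \<boxplus> g = g \<boxplus> f"
  using comm_monoid.m_comm[OF comm_group.axioms(1)[OF hom_comm_group[of a b]], of f g]
    Hom_Obj[OF assms(1)] assms
  by (simp add: hom_group_sel)

lemma Add_Zero:
  assumes "f \<in> Hom C a b"
  shows "f \<boxplus> Zero C a b = f" "Zero C a b \<boxplus> f = f"
  using monoid.r_one[OF group.is_monoid[OF hom_group_group[of a b]], of f]
    monoid.l_one[OF group.is_monoid[OF hom_group_group[of a b]], of f]
    Hom_Obj[OF assms(1)] assms
  by (simp_all add: hom_group_sel)

lemma Add_Neg:
  assumes "f \<in> Hom C a b"
  shows "f \<boxplus> Neg C f = Zero C a b" "Neg C f \<boxplus> f = Zero C a b"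
  using group.r_inv[OF hom_group_group[of a b], of f]
    group.l_inv[OF hom_group_group[of a b], of f]
    Hom_Obj[OF assms(1)] assms
  by (simp_all add: Neg_def hom_group_sel Hom_def)

lemma Add_left_cancel:
  assumes "f \<in> Hom C a b" "g \<in> Hom C a b" "h \<in> Hom C a b" "f \<boxplus> g = f \<boxplus> h"
  shows "g = h"
  using group.right_cancel[OF hom_group_group[of a b], of f g h]
    Hom_Obj[OF assms(1)] assms Add_commute[OF assms(1,2)] Add_commute[OF assms(1,3)]
  by (simp add: hom_group_sel)

lemma Add_idem_Zero:
  assumes "f \<in> Hom C a b" "f \<boxplus> f = f"
  shows "f = Zero C a b"
  using Add_left_cancel[of f a b f "Zero C a b"] assms Add_Zero Zero_Hom Hom_Obj by metis

lemma Comp_Zero: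
  assumes "g \<in> Hom C b c" "a \<in> Obj C"
  shows "g \<cdot> Zero C a b = Zero C a c"
proof -
  have z: "Zero C a b \<in> Hom C a b" using assms Zero_Hom Hom_Obj by blast
  show ?thesis
    using Comp_Add_right[OF z z assms(1)] Add_Zero(1)[OF z] Add_idem_Zero Comp_Hom[OF z assms(1)]
    by metis
qed

lemma Zero_Comp:
  assumes "f \<in> Hom C a b" "c \<in> Obj C"
  shows "Zero C b c \<cdot> f = Zero C a c"
proof -
  have z: "Zero C b c \<in> Hom C b c" using assms Zero_Hom Hom_Obj by blast
  show ?thesis
    using Comp_Add_left[OF assms(1) z z] Add_Zero(1)[OF z] Add_idem_Zero Comp_Hom[OF assms(1) z]
    by metis
qed

lemma ShObj_Obj: "a \<in> Obj C \<Longrightarrow> ShObj C a \<in> Obj C"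
  using ShObj_bij bij_betwE by metis

lemma ShArr_Zero:
  assumes "a \<in> Obj C" "b \<in> Obj C"
  shows "ShArr C (Zero C a b) = Zero C (ShObj C a) (ShObj C b)"
  using ShArr_Add[OF Zero_Hom[OF assms] Zero_Hom[OF assms]] Add_Zero(1)[OF Zero_Hom[OF assms]]
    Add_idem_Zero[OF ShArr_Hom[OF Zero_Hom[OF assms]]] by simp

lemma square_Add:
  assumes f: "f \<in> Hom C a a'" and f': "f' \<in> Hom C a a'"
    and g: "g \<in> Hom C b b'" and g': "g' \<in> Hom C b b'"
    and x: "x \<in> Hom C a b" and y: "y \<in> Hom C a' b'"
    and "g \<cdot> x = y \<cdot> f" "g' \<cdot> x = y \<cdot> f'"
  shows "(g \<boxplus> g') \<cdot> x = y \<cdot> (f \<boxplus> f')"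
  using assms Comp_Add_left[OF x g g'] Comp_Add_right[OF f f' y] by simp

lemma is_biproductD:
  assumes "is_biproduct C a b P"
  shows "Inj1 P \<in> Hom C a (Apex P)" "Inj2 P \<in> Hom C b (Apex P)"
    "Prj1 P \<in> Hom C (Apex P) a" "Prj2 P \<in> Hom C (Apex P) b"
    "Prj1 P \<cdot> Inj1 P = Ident C a" "Prj2 P \<cdot> Inj2 P = Ident C b"
    "Prj2 P \<cdot> Inj1 P = Zero C a b" "Prj1 P \<cdot> Inj2 P = Zero C b a"
    "Inj1 P \<cdot> Prj1 P \<boxplus> Inj2 P \<cdot> Prj2 P = Ident C (Apex P)"
    "a \<in> Obj C" "b \<in> Obj C" "Apex P \<in> Obj C"
  using assms Hom_Obj unfolding is_biproduct_def by blast+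

lemma shift_is_biproduct:
  assumes "is_biproduct C a b P"
  shows "is_biproduct C (ShObj C a) (ShObj C b) (shift_biproduct C P)"
proof -
  note P = is_biproductD[OF assms]
  have "ShArr C (Inj1 P \<cdot> Prj1 P \<boxplus> Inj2 P \<cdot> Prj2 P)
      = ShArr C (Inj1 P) \<cdot> ShArr C (Prj1 P) \<boxplus> ShArr C (Inj2 P) \<cdot> ShArr C (Prj2 P)"
    using ShArr_Add ShArr_Comp Comp_Hom P by metis
  then show ?thesis
    using P ShArr_Comp[OF P(1) P(3)] ShArr_Comp[OF P(2) P(4)] ShArr_Comp[OF P(1) P(4)]
      ShArr_Comp[OF P(2) P(3)]
    by (simp add: is_biproduct_def shift_biproduct_def ShObj_Obj ShArr_Hom ShArr_Ident ShArr_Zero)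
qed

lemma dsum_arr_props:
  assumes P': "is_biproduct C a b P" and Q': "is_biproduct C a' b' Q"
    and f: "f \<in> Hom C a a'" and g: "g \<in> Hom C b b'"
  shows "dsum_arr C P Q f g \<in> Hom C (Apex P) (Apex Q)"
    "dsum_arr C P Q f g \<cdot> Inj1 P = Inj1 Q \<cdot> f"
    "dsum_arr C P Q f g \<cdot> Inj2 P = Inj2 Q \<cdot> g"
    "Prj1 Q \<cdot> dsum_arr C P Q f g = f \<cdot> Prj1 P"
    "Prj2 Q \<cdot> dsum_arr C P Q f g = g \<cdot> Prj2 P"
proof -
  note P = is_biproductD[OF P'] and Q = is_biproductD[OF Q']
  have i1: "Inj1 Q \<cdot> f \<in> Hom C a (Apex Q)" and i2: "Inj2 Q \<cdot> g \<in> Hom C b (Apex Q)"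
    and t1: "Inj1 Q \<cdot> f \<cdot> Prj1 P \<in> Hom C (Apex P) (Apex Q)"
    and t2: "Inj2 Q \<cdot> g \<cdot> Prj2 P \<in> Hom C (Apex P) (Apex Q)"
    and p1: "f \<cdot> Prj1 P \<in> Hom C (Apex P) a'" and p2: "g \<cdot> Prj2 P \<in> Hom C (Apex P) b'"
    using P Q f g by (meson Comp_Hom)+
  show "dsum_arr C P Q f g \<in> Hom C (Apex P) (Apex Q)"
    unfolding dsum_arr_def by (rule Add_Hom[OF t1 t2])
  show "dsum_arr C P Q f g \<cdot> Inj1 P = Inj1 Q \<cdot> f"
    unfolding dsum_arr_def Comp_Add_left[OF P(1) t1 t2]
      Comp_assoc[OF P(1) P(3) i1] Comp_assoc[OF P(1) P(4) i2]
    using P Q i1 i2 by (simp add: Comp_Ident_right Comp_Zero Add_Zero)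
  show "dsum_arr C P Q f g \<cdot> Inj2 P = Inj2 Q \<cdot> g"
    unfolding dsum_arr_def Comp_Add_left[OF P(2) t1 t2]
      Comp_assoc[OF P(2) P(3) i1] Comp_assoc[OF P(2) P(4) i2]
    using P Q i1 i2 by (simp add: Comp_Ident_right Comp_Zero Add_Zero)
  have e1: "Inj1 Q \<cdot> f \<cdot> Prj1 P = Inj1 Q \<cdot> (f \<cdot> Prj1 P)"
    and e2: "Inj2 Q \<cdot> g \<cdot> Prj2 P = Inj2 Q \<cdot> (g \<cdot> Prj2 P)"
    using Comp_assoc P Q f g by blast+
  show "Prj1 Q \<cdot> dsum_arr C P Q f g = f \<cdot> Prj1 P"
    unfolding dsum_arr_def Comp_Add_right[OF t1 t2 Q(3)]
    unfolding e1 e2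
    unfolding Comp_assoc[OF p1 Q(1) Q(3), symmetric] Comp_assoc[OF p2 Q(2) Q(3), symmetric]
    using P Q p1 p2 by (simp add: Comp_Ident_left Zero_Comp Add_Zero)
  show "Prj2 Q \<cdot> dsum_arr C P Q f g = g \<cdot> Prj2 P"
    unfolding dsum_arr_def Comp_Add_right[OF t1 t2 Q(4)]
    unfolding e1 e2
    unfolding Comp_assoc[OF p1 Q(1) Q(4), symmetric] Comp_assoc[OF p2 Q(2) Q(4), symmetric]
    using P Q p1 p2 by (simp add: Comp_Ident_left Zero_Comp Add_Zero)
qed

text \<open>The endomorphism of \<open>a \<oplus> b\<close> whose matrix has \<open>1\<close> on the diagonal and
  \<open>m : a \<rightarrow> b\<close> as its only other nonzero entry.\<close>

definition shear :: "('o, 'm) biproduct \<Rightarrow> 'm \<Rightarrow> 'm" where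
  "shear P m = Ident C (Apex P) \<boxplus> Inj2 P \<cdot> m \<cdot> Prj1 P"

lemma shear_Hom:
  assumes "is_biproduct C a b P" "m \<in> Hom C a b"
  shows "shear P m \<in> Hom C (Apex P) (Apex P)"
  using is_biproductD[OF assms(1)] assms(2) unfolding shear_def
  by (meson Add_Hom Comp_Hom Ident_Hom)

text \<open>The product of the two off-diagonal parts contains \<open>Prj1 P \<cdot> Inj2 P = 0\<close>.\<close>

lemma shear_Comp:
  assumes P': "is_biproduct C a b P" and m: "m \<in> Hom C a b" and l: "l \<in> Hom C a b"
  shows "shear P m \<cdot> shear P l = shear P (m \<boxplus> l)"
proof -
  note P = is_biproductD[OF P']
  let ?m = "Inj2 P \<cdot> m \<cdot> Prj1 P" and ?l = "Inj2 P \<cdot> l \<cdot> Prj1 P"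
  have ml: "?m \<in> Hom C (Apex P) (Apex P)" "?l \<in> Hom C (Apex P) (Apex P)"
    and im: "Inj2 P \<cdot> m \<in> Hom C a (Apex P)" "Inj2 P \<cdot> l \<in> Hom C a (Apex P)"
    and lp: "l \<cdot> Prj1 P \<in> Hom C (Apex P) b"
    using P m l by (meson Comp_Hom)+
  have I: "Ident C (Apex P) \<in> Hom C (Apex P) (Apex P)" using P Ident_Hom by blast
  have "?m \<cdot> ?l = Inj2 P \<cdot> m \<cdot> (Prj1 P \<cdot> (Inj2 P \<cdot> (l \<cdot> Prj1 P)))"
    using Comp_assoc[OF ml(2) P(3) im(1)] Comp_assoc[OF P(3) l P(2)] by simp
  also have "Prj1 P \<cdot> (Inj2 P \<cdot> (l \<cdot> Prj1 P)) = Zero C (Apex P) a"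
    using Comp_assoc[OF lp P(2) P(3)] P Zero_Comp[OF lp] by simp
  finally have z: "?m \<cdot> ?l = Zero C (Apex P) (Apex P)"
    using Comp_Zero[OF im(1) P(12)] by simp
  have "shear P m \<cdot> shear P l = shear P m \<boxplus> shear P m \<cdot> ?l"
    using Comp_Add_right[OF I ml(2) shear_Hom[OF P' m]] Comp_Ident_right[OF shear_Hom[OF P' m]]
    by (simp add: shear_def[of P l])
  also have "shear P m \<cdot> ?l = ?l"
    using Comp_Add_left[OF ml(2) I ml(1)] z Comp_Ident_left[OF ml(2)] Add_Zero[OF ml(2)]
    by (simp add: shear_def)
  also have "shear P m \<boxplus> ?l = Ident C (Apex P) \<boxplus> (?m \<boxplus> ?l)"
    using Add_assoc[OF I ml] by (simp add: shear_def)
  also have "?m \<boxplus> ?l = Inj2 P \<cdot> (m \<boxplus> l) \<cdot> Prj1 P"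
    using Comp_Add_left[OF P(3) im] Comp_Add_right[OF m l P(2)] by simp
  finally show ?thesis by (simp add: shear_def)
qed

lemma shear_Zero:
  assumes P': "is_biproduct C a b P"
  shows "shear P (Zero C a b) = Ident C (Apex P)"
proof -
  note P = is_biproductD[OF P']
  show ?thesis
    using P Comp_Zero[OF P(2) P(10)] Zero_Comp[OF P(3) P(12)] Add_Zero(1)[OF Ident_Hom[OF P(12)]]
    by (simp add: shear_def)
qed

lemma shear_inverse:
  assumes P: "is_biproduct C a b P" and m: "m \<in> Hom C a b"
  shows "shear P (Neg C m) \<cdot> shear P m = Ident C (Apex P)"
    "shear P m \<cdot> shear P (Neg C m) = Ident C (Apex P)"
  using shear_Comp[OF P] shear_Zero[OF P] Neg_Hom[OF m] m Add_Neg[OF m] by simp_all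

lemma shear_entry:
  assumes P': "is_biproduct C a b P" and m: "m \<in> Hom C a b"
  shows "Prj2 P \<cdot> shear P m \<cdot> Inj1 P = m"
proof -
  note P = is_biproductD[OF P']
  have im: "Inj2 P \<cdot> m \<in> Hom C a (Apex P)" 
    and imp: "Inj2 P \<cdot> m \<cdot> Prj1 P \<in> Hom C (Apex P) (Apex P)" using P m by (meson Comp_Hom)+
  have "shear P m \<cdot> Inj1 P = Inj1 P \<boxplus> Inj2 P \<cdot> m"
    using Comp_Add_left[OF P(1) Ident_Hom[OF P(12)] imp] Comp_assoc[OF P(1) P(3) im]
      Comp_Ident_left[OF P(1)] Comp_Ident_right[OF im] P
    by (simp add: shear_def)
  then have "Prj2 P \<cdot> shear P m \<cdot> Inj1 P = Zero C a b \<boxplus> Prj2 P \<cdot> (Inj2 P \<cdot> m)"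
    using Comp_assoc[OF P(1) shear_Hom[OF P' m] P(4)] Comp_Add_right[OF P(1) im P(4)] P by simp
  also have "\<dots> = m"
    using Comp_assoc[OF m P(2) P(4)] P Comp_Ident_left[OF m] Add_Zero[OF m] by simp
  finally show ?thesis .
qed

section \<open>Weak cokernels and unipotent endomorphisms\<close>

text \<open>The part of the long exact sequence of a triangle that the argument uses: for \<open>v : b \<rightarrow> c\<close> and
  \<open>w : c \<rightarrow> d\<close>, the kernel of \<open>Hom(c, x) \<rightarrow> Hom(b, x)\<close> lies in the image of
  \<open>Hom(d, x) \<rightarrow> Hom(c, x)\<close>.\<close>

definition weak_cokernel :: "'m \<Rightarrow> 'm \<Rightarrow> bool" where
  "weak_cokernel v w \<longleftrightarrow> (\<forall>x. \<forall>z \<in> Hom C (Cod C v) x. z \<cdot> v = Zero C (Dom C v) x \<longrightarrow>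
     (\<exists>y \<in> Hom C (Cod C w) x. z = y \<cdot> w))"

text \<open>This replaces the five lemma.  The arrow \<open>n = 1 - e\<close> kills \<open>v\<close>, so \<open>n = y w\<close> for some \<open>y\<close>;
  since \<open>w e = w\<close>, also \<open>n e = n\<close>, that is \<open>n\<^sup>2 = 0\<close>.  Hence \<open>1 + n\<close> is inverse to \<open>e = 1 - n\<close>.\<close>

lemma unipotent_invertible:
  assumes v: "v \<in> Hom C b c" and w: "w \<in> Hom C c d" and e: "e \<in> Hom C c c"
    and W: "weak_cokernel v w" and ev: "e \<cdot> v = v" and we: "w \<cdot> e = w"
  shows "\<exists>r \<in> Hom C c c. r \<cdot> e = Ident C c \<and> e \<cdot> r = Ident C c"
proof -
  have c: "c \<in> Obj C" and I: "Ident C c \<in> Hom C c c" using Hom_Obj v Ident_Hom by blast+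
  define n where "n = Ident C c \<boxplus> Neg C e"
  have n: "n \<in> Hom C c c" and ne1: "n \<boxplus> e = Ident C c" "e \<boxplus> n = Ident C c"
  proof -
    show n: "n \<in> Hom C c c" using Add_Hom[OF I Neg_Hom[OF e]] by (simp add: n_def)
    show "n \<boxplus> e = Ident C c"
      using Add_assoc[OF I Neg_Hom[OF e] e] Add_Neg[OF e] Add_Zero[OF I] by (simp add: n_def)
    then show "e \<boxplus> n = Ident C c" using Add_commute[OF e n] by simp
  qed
  have nv: "n \<cdot> v \<in> Hom C b c" by (rule Comp_Hom[OF v n])
  have "v \<boxplus> n \<cdot> v = v" using Comp_Add_left[OF v e n] ne1 ev Comp_Ident_left[OF v] by simp
  then have "n \<cdot> v = Zero C b c"
    using Add_left_cancel[OF v nv Zero_Hom] Add_Zero[OF v] Hom_Obj[OF v] by simp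
  then obtain y where y: "y \<in> Hom C d c" "n = y \<cdot> w"
    using W n v w unfolding weak_cokernel_def by (auto simp: Hom_def)
  have ne: "n \<cdot> e = n" using Comp_assoc[OF e w y(1)] we y by simp
  \<comment> \<open>\<open>e\<close> commutes with \<open>n = 1 - e\<close>: adding \<open>e e\<close> to either product gives \<open>e\<close>.\<close>
  have en: "e \<cdot> n = n"
  proof -
    have "e \<cdot> e \<boxplus> e \<cdot> n = e" using Comp_Add_right[OF e n e] ne1 Comp_Ident_right[OF e] by simp
    moreover have "e \<cdot> e \<boxplus> n \<cdot> e = e" using Comp_Add_left[OF e e n] ne1 Comp_Ident_left[OF e] by simp
    ultimately show ?thesis
      using Add_left_cancel[OF Comp_Hom[OF e e] Comp_Hom[OF n e] Comp_Hom[OF e n]]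
        ne Comp_Hom[OF n e] Comp_Hom[OF e n] Comp_Hom[OF e e]
        Add_left_cancel[OF Comp_Hom[OF e e] Comp_Hom[OF n e] Comp_Hom[OF n e]] by metis
  qed
  have "(Ident C c \<boxplus> n) \<cdot> e = Ident C c" "e \<cdot> (Ident C c \<boxplus> n) = Ident C c"
    using Comp_Add_left[OF e I n] Comp_Add_right[OF I n e] ne en ne1
      Comp_Ident_left[OF e] Comp_Ident_right[OF e] by simp_all
  then show ?thesis using Add_Hom[OF I n] by blast
qed


end

section \<open>Two-triangles and their morphisms\<close>

text \<open>The parts of a 2-triangle, named as in \<open>a \<rightarrow> b \<rightarrow> c \<rightarrow> a[1]\<close> with edges \<open>u\<close>, \<open>v\<close>, \<open>w\<close>.\<close>

definition Va :: "('o, 'm) triangle \<Rightarrow> 'o" where "Va A = Vx A 0 1"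
definition Vb :: "('o, 'm) triangle \<Rightarrow> 'o" where "Vb A = Vx A 0 2"
definition Vc :: "('o, 'm) triangle \<Rightarrow> 'o" where "Vc A = Vx A 1 2"
definition Eu :: "('o, 'm) triangle \<Rightarrow> 'm" where "Eu A = E1 A 0 1 2"
definition Ev :: "('o, 'm) triangle \<Rightarrow> 'm" where "Ev A = E2 A 0 1 2"
definition Ew :: "('o, 'm) triangle \<Rightarrow> 'm" where "Ew A = E3 A 0 1 2"

lemma triangle2_sel:
  "Va (triangle2 a b c u v w) = a" "Vb (triangle2 a b c u v w) = b" "Vc (triangle2 a b c u v w) = c"
  "Eu (triangle2 a b c u v w) = u" "Ev (triangle2 a b c u v w) = v" "Ew (triangle2 a b c u v w) = w"
  by (simp_all add: Va_def Vb_def Vc_def Eu_def Ev_def Ew_def triangle2_def mk_triangle_def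
      restr2_def restr3_def)

lemma pairs_upto_2: "(i::nat) < j \<and> j \<le> 2 \<longleftrightarrow> (i, j) \<in> {(0, 1), (0, 2), (1, 2)}"
  by auto

lemma triples_upto_2: "(i::nat) < j \<and> j < k \<and> k \<le> 2 \<longleftrightarrow> i = 0 \<and> j = 1 \<and> k = 2"
  by auto

lemma all_pairs_2: "(\<forall>i j. (i::nat) < j \<and> j \<le> 2 \<longrightarrow> P i j) \<longleftrightarrow> P 0 1 \<and> P 0 2 \<and> P 1 2"
  unfolding pairs_upto_2 by auto

lemma all_triples_2:
  "(\<forall>i j k. (i::nat) < j \<and> j < k \<and> k \<le> 2 \<longrightarrow> P i j k) \<longleftrightarrow> P 0 1 2"
  unfolding triples_upto_2 by auto

lemma mk_triangle_2:
  "mk_triangle 2 x p q r = triangle2 (x 0 1) (x 0 2) (x 1 2) (p 0 1 2) (q 0 1 2) (r 0 1 2)"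
  unfolding triangle2_def mk_triangle_def restr2_def restr3_def pairs_upto_2 triples_upto_2
  by (auto intro!: ext)

lemma mk_triangle_map_2:
  "mk_triangle_map 2 A B \<phi> = triangle2_map A B (\<phi> 0 1) (\<phi> 0 2) (\<phi> 1 2)"
  unfolding triangle2_map_def mk_triangle_map_def restr2_def pairs_upto_2
  by (auto intro!: ext)

lemma triangle2_map_sel:
  "Src (triangle2_map A B f g h) = A" "Tgt (triangle2_map A B f g h) = B"
  "Cmp (triangle2_map A B f g h) 0 1 = f" "Cmp (triangle2_map A B f g h) 0 2 = g"
  "Cmp (triangle2_map A B f g h) 1 2 = h"
  by (simp_all add: triangle2_map_def mk_triangle_map_def restr2_def)

lemma mk_simplex_sel:
  "1 \<le> j \<Longrightarrow> j \<le> n \<Longrightarrow> SVx (mk_simplex n x e) j = x j"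
  "1 \<le> j \<Longrightarrow> j < k \<Longrightarrow> k \<le> n \<Longrightarrow> SEdge (mk_simplex n x e) j k = e j k"
  by (simp_all add: mk_simplex_def)

context additive_shift_category begin

lemma is_simplex_2:
  "is_simplex C 2 (mk_simplex 2 x e) \<longleftrightarrow> e 1 2 \<in> Hom C (x 1) (x 2)"
proof -
  have "mk_simplex 2 x e
      = mk_simplex 2 (SVx (mk_simplex 2 x e)) (SEdge (mk_simplex 2 x e))"
    by (auto simp: mk_simplex_def intro!: ext)
  moreover have "1 \<le> j \<and> j \<le> 2 \<longleftrightarrow> j = 1 \<or> j = 2"
    "1 \<le> j \<and> j < k \<and> k \<le> 2 \<longleftrightarrow> j = 1 \<and> k = 2"
    "1 \<le> j \<and> j < k \<and> k < l \<and> l \<le> 2 \<longleftrightarrow> False" for j k l :: nat by auto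
  ultimately show ?thesis
    using Hom_Obj[of "e 1 2" "x 1" "x 2"] unfolding is_simplex_def
    by (auto simp: mk_simplex_sel)
qed

text \<open>Conditions (S) and (Q) compare composites of edges with four distinct indices in all, so they are
  empty for \<open>n = 2\<close> and only the types of the three edges remain.\<close>

lemma is_triangle_2:
  "is_triangle C 2 A \<longleftrightarrow>
     A = triangle2 (Va A) (Vb A) (Vc A) (Eu A) (Ev A) (Ew A) \<and>
     Eu A \<in> Hom C (Va A) (Vb A) \<and> Ev A \<in> Hom C (Vb A) (Vc A) \<and>
     Ew A \<in> Hom C (Vc A) (ShObj C (Va A))"
proof -
  have "lines_commute C 2 A" "squares_commute C 2 A"
    by (auto simp: lines_commute_def squares_commute_def)
  then show ?thesis
    unfolding is_triangle_def all_pairs_2 all_triples_2 mk_triangle_2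
    unfolding Va_def[symmetric] Vb_def[symmetric] Vc_def[symmetric]
      Eu_def[symmetric] Ev_def[symmetric] Ew_def[symmetric]
    using Hom_Obj by blast
qed

lemma is_triangle_2D:
  assumes "is_triangle C 2 A"
  shows "Eu A \<in> Hom C (Va A) (Vb A)" "Ev A \<in> Hom C (Vb A) (Vc A)"
    "Ew A \<in> Hom C (Vc A) (ShObj C (Va A))"
  using assms unfolding is_triangle_2 by blast+

lemma is_triangle_triangle2:
  "\<lbrakk>u \<in> Hom C a b; v \<in> Hom C b c; w \<in> Hom C c (ShObj C a)\<rbrakk>
     \<Longrightarrow> is_triangle C 2 (triangle2 a b c u v w)"
  by (simp add: is_triangle_2 triangle2_sel)

text \<open>The equations for \<open>(f, g, h) : A \<rightarrow> B\<close>, on which sums and composites can be taken componentwise.\<close>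

definition triangle2_hom ::
  "('o, 'm) triangle \<Rightarrow> ('o, 'm) triangle \<Rightarrow> 'm \<Rightarrow> 'm \<Rightarrow> 'm \<Rightarrow> bool" where
  "triangle2_hom A B f g h \<longleftrightarrow> is_triangle C 2 A \<and> is_triangle C 2 B \<and>
     f \<in> Hom C (Va A) (Va B) \<and> g \<in> Hom C (Vb A) (Vb B) \<and> h \<in> Hom C (Vc A) (Vc B) \<and>
     g \<cdot> Eu A = Eu B \<cdot> f \<and> h \<cdot> Ev A = Ev B \<cdot> g \<and> ShArr C f \<cdot> Ew A = Ew B \<cdot> h"

lemma is_triangle_map_2: "is_triangle_map C 2 (triangle2_map A B f g h) \<longleftrightarrow> triangle2_hom A B f g h"
  unfolding is_triangle_map_def all_pairs_2 all_triples_2 mk_triangle_map_2 triangle2_map_sel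
    triangle2_hom_def Va_def Vb_def Vc_def Eu_def Ev_def Ew_def
  by blast

lemma triangle_map_2_eq:
  assumes "is_triangle_map C 2 G"
  shows "G = triangle2_map (Src G) (Tgt G) (Cmp G 0 1) (Cmp G 0 2) (Cmp G 1 2)"
  using assms unfolding is_triangle_map_def mk_triangle_map_2 by blast

lemma triangle2_homD:
  assumes "triangle2_hom A B f g h"
  shows "Eu A \<in> Hom C (Va A) (Vb A)" "Ev A \<in> Hom C (Vb A) (Vc A)"
    "Ew A \<in> Hom C (Vc A) (ShObj C (Va A))"
    "Eu B \<in> Hom C (Va B) (Vb B)" "Ev B \<in> Hom C (Vb B) (Vc B)"
    "Ew B \<in> Hom C (Vc B) (ShObj C (Va B))"
    "f \<in> Hom C (Va A) (Va B)" "g \<in> Hom C (Vb A) (Vb B)" "h \<in> Hom C (Vc A) (Vc B)"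
    "ShArr C f \<in> Hom C (ShObj C (Va A)) (ShObj C (Va B))"
    "g \<cdot> Eu A = Eu B \<cdot> f" "h \<cdot> Ev A = Ev B \<cdot> g" "ShArr C f \<cdot> Ew A = Ew B \<cdot> h"
    "is_triangle C 2 A" "is_triangle C 2 B"
  using assms is_triangle_2D ShArr_Hom unfolding triangle2_hom_def by blast+

lemma triangle2_hom_Ident:
  assumes "is_triangle C 2 A"
  shows "triangle2_hom A A (Ident C (Va A)) (Ident C (Vb A)) (Ident C (Vc A))"
proof -
  have A: "Eu A \<in> Hom C (Va A) (Vb A)" "Ev A \<in> Hom C (Vb A) (Vc A)"
    "Ew A \<in> Hom C (Vc A) (ShObj C (Va A))" by (rule is_triangle_2D[OF assms])+
  then show ?thesis
    using assms Hom_Obj[OF A(1)] Hom_Obj[OF A(2)] Comp_Ident_left[OF A(1)] Comp_Ident_left[OF A(2)]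
      Comp_Ident_left[OF A(3)] Comp_Ident_right[OF A(1)] Comp_Ident_right[OF A(2)]
      Comp_Ident_right[OF A(3)]
    by (simp add: triangle2_hom_def Ident_Hom ShArr_Ident)
qed

lemma triangle2_hom_Comp:
  assumes 1: "triangle2_hom A B f g h" and 2: "triangle2_hom B D f' g' h'"
  shows "triangle2_hom A D (f' \<cdot> f) (g' \<cdot> g) (h' \<cdot> h)"
proof -
  note m1 = triangle2_homD[OF 1] and m2 = triangle2_homD[OF 2]
  show ?thesis
    unfolding triangle2_hom_def ShArr_Comp[OF m1(7) m2(7)]
    using m1(14) m2(15) Comp_Hom[OF m1(7) m2(7)] Comp_Hom[OF m1(8) m2(8)] Comp_Hom[OF m1(9) m2(9)]
      square_paste[OF m1(7) m2(7) m1(8) m2(8) m1(1) m2(1) m2(4) m1(11) m2(11)]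
      square_paste[OF m1(8) m2(8) m1(9) m2(9) m1(2) m2(2) m2(5) m1(12) m2(12)]
      square_paste[OF m1(9) m2(9) m1(10) m2(10) m1(3) m2(3) m2(6) m1(13) m2(13)]
    by blast
qed

lemma triangle2_hom_Add:
  assumes 1: "triangle2_hom A B f g h" and 2: "triangle2_hom A B f' g' h'"
  shows "triangle2_hom A B (f \<boxplus> f') (g \<boxplus> g') (h \<boxplus> h')"
proof -
  note m1 = triangle2_homD[OF 1] and m2 = triangle2_homD[OF 2]
  show ?thesis
    unfolding triangle2_hom_def ShArr_Add[OF m1(7) m2(7)]
    using m1(14) m1(15) Add_Hom[OF m1(7) m2(7)] Add_Hom[OF m1(8) m2(8)] Add_Hom[OF m1(9) m2(9)]
      square_Add[OF m1(7) m2(7) m1(8) m2(8) m1(1) m1(4) m1(11) m2(11)]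
      square_Add[OF m1(8) m2(8) m1(9) m2(9) m1(2) m1(5) m1(12) m2(12)]
      square_Add[OF m1(9) m2(9) m1(10) m2(10) m1(3) m1(6) m1(13) m2(13)]
    by blast
qed

definition arr_inverse :: "'m \<Rightarrow> 'm \<Rightarrow> bool" where
  "arr_inverse f f' \<longleftrightarrow> f \<in> Arr C \<and> f' \<in> Hom C (Cod C f) (Dom C f) \<and>
     f' \<cdot> f = Ident C (Dom C f) \<and> f \<cdot> f' = Ident C (Cod C f)"

lemma arr_inverseD:
  assumes "arr_inverse f f'" "f \<in> Hom C a b"
  shows "f' \<in> Hom C b a" "f' \<cdot> f = Ident C a" "f \<cdot> f' = Ident C b"
  using assms by (auto simp: arr_inverse_def Hom_def)

lemma arr_inverseI:
  "\<lbrakk>f \<in> Hom C a b; f' \<in> Hom C b a; f' \<cdot> f = Ident C a; f \<cdot> f' = Ident C b\<rbrakk> \<Longrightarrow> arr_inverse f f'"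
  by (auto simp: arr_inverse_def Hom_def)

lemma arr_inverse_Ident: "a \<in> Obj C \<Longrightarrow> arr_inverse (Ident C a) (Ident C a)"
  using arr_inverseI Ident_Hom Comp_Ident_left[OF Ident_Hom] by blast

lemma triangle2_hom_inverse:
  assumes 1: "triangle2_hom A B f g h"
    and f: "arr_inverse f f'" and g: "arr_inverse g g'" and h: "arr_inverse h h'"
  shows "triangle2_hom B A f' g' h'" "is_iso (triangle_category C 2) (triangle2_map A B f g h)"
proof -
  note m = triangle2_homD[OF 1]
  note f' = arr_inverseD[OF f m(7)] and g' = arr_inverseD[OF g m(8)] and h' = arr_inverseD[OF h m(9)]
  have s: "ShArr C f' \<in> Hom C (ShObj C (Va B)) (ShObj C (Va A))"
    "ShArr C f' \<cdot> ShArr C f = Ident C (ShObj C (Va A))"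
    using ShArr_Hom[OF f'(1)] ShArr_Comp[OF m(7) f'(1)] f'(2) ShArr_Ident Hom_Obj[OF m(7)] by simp_all
  show B: "triangle2_hom B A f' g' h'"
    unfolding triangle2_hom_def
    using m(14,15) f'(1) g'(1) h'(1)
      square_inverse[OF m(7) f'(1) m(8) g'(1) m(1) m(4) f'(3) g'(2) m(11)]
      square_inverse[OF m(8) g'(1) m(9) h'(1) m(2) m(5) g'(3) h'(2) m(12)]
      square_inverse[OF m(9) h'(1) m(10) s(1) m(3) m(6) h'(3) s(2) m(13)]
    by blast
  have "triangle2_map B A f' g' h' \<in> Hom (triangle_category C 2) B A"
    using B by (simp add: Hom_def triangle_category_def is_triangle_map_2 triangle2_map_sel)
  moreover have "Comp (triangle_category C 2) (triangle2_map B A f' g' h') (triangle2_map A B f g h)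
      = Ident (triangle_category C 2) A"
    using f' g' h' by (simp add: triangle_category_def mk_triangle_map_2 triangle2_map_sel
        Va_def[symmetric] Vb_def[symmetric] Vc_def[symmetric] del: One_nat_def)
  moreover have "Comp (triangle_category C 2) (triangle2_map A B f g h) (triangle2_map B A f' g' h')
      = Ident (triangle_category C 2) B"
    using f' g' h' by (simp add: triangle_category_def mk_triangle_map_2 triangle2_map_sel
        Va_def[symmetric] Vb_def[symmetric] Vc_def[symmetric] del: One_nat_def)
  ultimately show "is_iso (triangle_category C 2) (triangle2_map A B f g h)"
    using 1 unfolding is_iso_def
    by (intro conjI bexI[of _ "triangle2_map B A f' g' h'"])
      (simp_all add: triangle_category_def is_triangle_map_2 triangle2_map_sel)
qed

section \<open>Biproducts of two-triangles\<close>

text \<open>A biproduct in the category of 2-triangles, by the structure maps instead of by matrices: every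
  use of the sum below goes through its injections and projections.\<close>

definition triangle2_biproduct ::
  "('o, 'm) triangle \<Rightarrow> ('o, 'm) triangle \<Rightarrow> ('o, 'm) triangle
     \<Rightarrow> ('o, 'm) biproduct \<Rightarrow> ('o, 'm) biproduct \<Rightarrow> ('o, 'm) biproduct \<Rightarrow> bool" where
  "triangle2_biproduct A B S P Q R \<longleftrightarrow>
     is_biproduct C (Va A) (Va B) P \<and> is_biproduct C (Vb A) (Vb B) Q \<and> is_biproduct C (Vc A) (Vc B) R \<and>
     Va S = Apex P \<and> Vb S = Apex Q \<and> Vc S = Apex R \<and>
     triangle2_hom A S (Inj1 P) (Inj1 Q) (Inj1 R) \<and> triangle2_hom B S (Inj2 P) (Inj2 Q) (Inj2 R) \<and>
     triangle2_hom S A (Prj1 P) (Prj1 Q) (Prj1 R) \<and> triangle2_hom S B (Prj2 P) (Prj2 Q) (Prj2 R)"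

lemma triangle2_biproductD:
  assumes "triangle2_biproduct A B S P Q R"
  shows "is_biproduct C (Va A) (Va B) P" "is_biproduct C (Vb A) (Vb B) Q"
    "is_biproduct C (Vc A) (Vc B) R" "Va S = Apex P" "Vb S = Apex Q" "Vc S = Apex R"
    "triangle2_hom A S (Inj1 P) (Inj1 Q) (Inj1 R)" "triangle2_hom B S (Inj2 P) (Inj2 Q) (Inj2 R)"
    "triangle2_hom S A (Prj1 P) (Prj1 Q) (Prj1 R)" "triangle2_hom S B (Prj2 P) (Prj2 Q) (Prj2 R)"
  using assms unfolding triangle2_biproduct_def by blast+

definition dsum_triangle ::
  "('o, 'm) biproduct \<Rightarrow> ('o, 'm) biproduct \<Rightarrow> ('o, 'm) biproduct
     \<Rightarrow> ('o, 'm) triangle \<Rightarrow> ('o, 'm) triangle \<Rightarrow> ('o, 'm) triangle" where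
  "dsum_triangle P Q R A B = triangle2 (Apex P) (Apex Q) (Apex R)
     (dsum_arr C P Q (Eu A) (Eu B)) (dsum_arr C Q R (Ev A) (Ev B))
     (dsum_arr C R (shift_biproduct C P) (Ew A) (Ew B))"

lemma dsum_triangle_biproduct:
  assumes A: "is_triangle C 2 A" and B: "is_triangle C 2 B"
    and P: "is_biproduct C (Va A) (Va B) P" and Q: "is_biproduct C (Vb A) (Vb B) Q"
    and R: "is_biproduct C (Vc A) (Vc B) R"
  shows "triangle2_biproduct A B (dsum_triangle P Q R A B) P Q R"
proof -
  have a: "Eu A \<in> Hom C (Va A) (Vb A)" "Ev A \<in> Hom C (Vb A) (Vc A)"
    "Ew A \<in> Hom C (Vc A) (ShObj C (Va A))" by (rule is_triangle_2D[OF A])+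
  have b: "Eu B \<in> Hom C (Va B) (Vb B)" "Ev B \<in> Hom C (Vb B) (Vc B)"
    "Ew B \<in> Hom C (Vc B) (ShObj C (Va B))" by (rule is_triangle_2D[OF B])+
  note u = dsum_arr_props[OF P Q a(1) b(1)] and v = dsum_arr_props[OF Q R a(2) b(2)]
    and w = dsum_arr_props[OF R shift_is_biproduct[OF P] a(3) b(3)]
  have sel: "Apex (shift_biproduct C P) = ShObj C (Apex P)"
    "Inj1 (shift_biproduct C P) = ShArr C (Inj1 P)" "Inj2 (shift_biproduct C P) = ShArr C (Inj2 P)"
    "Prj1 (shift_biproduct C P) = ShArr C (Prj1 P)" "Prj2 (shift_biproduct C P) = ShArr C (Prj2 P)"
    by (simp_all add: shift_biproduct_def)
  have S: "is_triangle C 2 (dsum_triangle P Q R A B)"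
    unfolding dsum_triangle_def using u(1) v(1) w(1) unfolding sel by (rule is_triangle_triangle2)
  show ?thesis
    unfolding triangle2_biproduct_def triangle2_hom_def
    using A B P Q R S u v w is_biproductD[OF P] is_biproductD[OF Q] is_biproductD[OF R]
    by (simp add: dsum_triangle_def triangle2_sel sel)
qed

lemma triangle2_hom_dsum:
  assumes S: "triangle2_biproduct A B S P Q R" and S': "triangle2_biproduct A' B' S' P' Q' R'"
    and 1: "triangle2_hom A A' f g h" and 2: "triangle2_hom B B' f' g' h'"
  shows "triangle2_hom S S' (dsum_arr C P P' f f') (dsum_arr C Q Q' g g') (dsum_arr C R R' h h')"
  unfolding dsum_arr_def
  using triangle2_biproductD[OF S] triangle2_biproductD[OF S'] 1 2 by (meson triangle2_hom_Add triangle2_hom_Comp)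

lemma weak_cokernelD:
  assumes "weak_cokernel v w" "v \<in> Hom C b c" "w \<in> Hom C c d" "z \<in> Hom C c x"
    "z \<cdot> v = Zero C b x"
  obtains y where "y \<in> Hom C d x" "z = y \<cdot> w"
  using assms unfolding weak_cokernel_def by (auto simp: Hom_def)

lemma weak_cokernelI:
  assumes "v \<in> Hom C b c" "w \<in> Hom C c d"
    "\<And>x z. z \<in> Hom C c x \<Longrightarrow> z \<cdot> v = Zero C b x \<Longrightarrow> \<exists>y \<in> Hom C d x. z = y \<cdot> w"
  shows "weak_cokernel v w"
  using assms unfolding weak_cokernel_def by (auto simp: Hom_def)

lemma Comp_Ev_Zero_of_hom:
  assumes m: "triangle2_hom A B f g h" and z: "z \<in> Hom C (Vc B) x" and zv: "z \<cdot> Ev B = Zero C (Vb B) x"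
  shows "(z \<cdot> h) \<cdot> Ev A = Zero C (Vb A) x"
proof -
  note m = triangle2_homD[OF m]
  have "(z \<cdot> h) \<cdot> Ev A = z \<cdot> (Ev B \<cdot> g)" using Comp_assoc[OF m(2) m(9) z] m(12) by simp
  also have "\<dots> = Zero C (Vb A) x"
    using Comp_assoc[OF m(8) m(5) z] zv Zero_Comp[OF m(8)] Hom_Obj[OF z] by simp
  finally show ?thesis .
qed

text \<open>An arrow \<open>z\<close> killing \<open>v\<^sub>S\<close> restricts to arrows killing \<open>v\<^sub>A\<close> and \<open>v\<^sub>B\<close>; factor these as \<open>y\<^sub>1 w\<^sub>A\<close> and
  \<open>y\<^sub>2 w\<^sub>B\<close> and put \<open>y\<^sub>1\<close> and \<open>y\<^sub>2\<close> together again with the shifted projections.\<close>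

lemma weak_cokernel_dsum:
  assumes S: "triangle2_biproduct A B S P Q R"
    and wA: "weak_cokernel (Ev A) (Ew A)" and wB: "weak_cokernel (Ev B) (Ew B)"
  shows "weak_cokernel (Ev S) (Ew S)"
proof -
  note S' = triangle2_biproductD[OF S]
  note R = is_biproductD[OF S'(3)]
  note i1 = triangle2_homD[OF S'(7)] and i2 = triangle2_homD[OF S'(8)]
  note p1 = triangle2_homD[OF S'(9)] and p2 = triangle2_homD[OF S'(10)]
  show ?thesis
  proof (rule weak_cokernelI[OF i1(5) i1(6)])
    fix x z assume z: "z \<in> Hom C (Vc S) x" and zv: "z \<cdot> Ev S = Zero C (Vb S) x"
    obtain y1 where y1: "y1 \<in> Hom C (ShObj C (Va A)) x" "z \<cdot> Inj1 R = y1 \<cdot> Ew A"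
      by (rule weak_cokernelD[OF wA i1(2,3) Comp_Hom[OF i1(9) z] Comp_Ev_Zero_of_hom[OF S'(7) z zv]])
    obtain y2 where y2: "y2 \<in> Hom C (ShObj C (Va B)) x" "z \<cdot> Inj2 R = y2 \<cdot> Ew B"
      by (rule weak_cokernelD[OF wB i2(2,3) Comp_Hom[OF i2(9) z] Comp_Ev_Zero_of_hom[OF S'(8) z zv]])
    let ?y = "y1 \<cdot> ShArr C (Prj1 P) \<boxplus> y2 \<cdot> ShArr C (Prj2 P)"
    have y: "?y \<in> Hom C (ShObj C (Va S)) x"
      by (rule Add_Hom[OF Comp_Hom[OF p1(10) y1(1)] Comp_Hom[OF p2(10) y2(1)]])
    have "?y \<cdot> Ew S = (y1 \<cdot> ShArr C (Prj1 P)) \<cdot> Ew S \<boxplus> (y2 \<cdot> ShArr C (Prj2 P)) \<cdot> Ew S"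
      by (rule Comp_Add_left[OF p1(3) Comp_Hom[OF p1(10) y1(1)] Comp_Hom[OF p2(10) y2(1)]])
    also have "(y1 \<cdot> ShArr C (Prj1 P)) \<cdot> Ew S = z \<cdot> (Inj1 R \<cdot> Prj1 R)"
      using Comp_assoc[OF p1(3) p1(10) y1(1)] Comp_assoc[OF p1(9) p1(6) y1(1)] p1(13)
        Comp_assoc[OF p1(9) i1(9) z] y1(2) by simp
    also have "(y2 \<cdot> ShArr C (Prj2 P)) \<cdot> Ew S = z \<cdot> (Inj2 R \<cdot> Prj2 R)"
      using Comp_assoc[OF p2(3) p2(10) y2(1)] Comp_assoc[OF p2(9) p2(6) y2(1)] p2(13)
        Comp_assoc[OF p2(9) i2(9) z] y2(2) by simp
    also have "z \<cdot> (Inj1 R \<cdot> Prj1 R) \<boxplus> z \<cdot> (Inj2 R \<cdot> Prj2 R)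
        = z \<cdot> (Inj1 R \<cdot> Prj1 R \<boxplus> Inj2 R \<cdot> Prj2 R)"
      using Comp_Add_right[OF Comp_Hom[OF p1(9) i1(9)] Comp_Hom[OF p2(9) i2(9)] z] by simp
    also have "\<dots> = z" using R(9) S'(6) Comp_Ident_right[OF z] by simp
    finally show "\<exists>y \<in> Hom C (ShObj C (Va S)) x. z = y \<cdot> Ew S" using y by metis
  qed
qed

text \<open>An arrow \<open>z\<close> killing \<open>v\<^sub>A\<close> gives \<open>z p\<^sub>c = y w\<^sub>S\<close>, whence \<open>z = z p\<^sub>c i\<^sub>c = y w\<^sub>S i\<^sub>c = y i\<^sub>a[1] w\<^sub>A\<close>.\<close>

lemma weak_cokernel_retract:
  assumes i: "triangle2_hom A S i\<^sub>a i\<^sub>b i\<^sub>c" and p: "triangle2_hom S A p\<^sub>a p\<^sub>b p\<^sub>c"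
    and pi: "p\<^sub>c \<cdot> i\<^sub>c = Ident C (Vc A)" and wS: "weak_cokernel (Ev S) (Ew S)"
  shows "weak_cokernel (Ev A) (Ew A)"
proof -
  note i' = triangle2_homD[OF i] and p' = triangle2_homD[OF p]
  show ?thesis
  proof (rule weak_cokernelI[OF i'(2,3)])
    fix x z assume z: "z \<in> Hom C (Vc A) x" and zv: "z \<cdot> Ev A = Zero C (Vb A) x"
    obtain y where y: "y \<in> Hom C (ShObj C (Va S)) x" "z \<cdot> p\<^sub>c = y \<cdot> Ew S"
      by (rule weak_cokernelD[OF wS p'(2,3) Comp_Hom[OF p'(9) z] Comp_Ev_Zero_of_hom[OF p z zv]])
    have "z = z \<cdot> (p\<^sub>c \<cdot> i\<^sub>c)" using pi Comp_Ident_right[OF z] by simp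
    also have "\<dots> = y \<cdot> (Ew S \<cdot> i\<^sub>c)"
      using Comp_assoc[OF i'(9) p'(9) z] Comp_assoc[OF i'(9) p'(3) y(1)] y(2) by simp
    also have "\<dots> = (y \<cdot> ShArr C i\<^sub>a) \<cdot> Ew A"
      using Comp_assoc[OF i'(3) i'(10) y(1)] i'(13) by simp
    finally show "\<exists>y \<in> Hom C (ShObj C (Va A)) x. z = y \<cdot> Ew A"
      using Comp_Hom[OF i'(10) y(1)] by blast
  qed
qed

text \<open>Both composites of \<open>k\<close> and \<open>p\<close> are third components of endomorphisms \<open>(1, 1, e)\<close>, hence
  unipotent.\<close>

lemma triangle2_hom_over_Ident_invertible:
  assumes k: "triangle2_hom A B (Ident C a) (Ident C b) k" and p: "triangle2_hom B A (Ident C a) (Ident C b) p"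
    and V: "Va A = a" "Va B = a" "Vb A = b" "Vb B = b"
    and wA: "weak_cokernel (Ev A) (Ew A)" and wB: "weak_cokernel (Ev B) (Ew B)"
  shows "\<exists>k'. arr_inverse k k'"
proof -
  have endo: "\<exists>r \<in> Hom C (Vc D) (Vc D). r \<cdot> e = Ident C (Vc D) \<and> e \<cdot> r = Ident C (Vc D)"
    if D: "triangle2_hom D D (Ident C a \<cdot> Ident C a) (Ident C b \<cdot> Ident C b) e" and V: "Va D = a" "Vb D = b"
      and w: "weak_cokernel (Ev D) (Ew D)" for D e
  proof -
    note e = triangle2_homD[OF D]
    have ab: "a \<in> Obj C" "b \<in> Obj C" using Hom_Obj[OF e(1)] V by simp_all
    note I = Comp_Ident_left[OF Ident_Hom[OF ab(1)]] Comp_Ident_left[OF Ident_Hom[OF ab(2)]]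
    have "e \<cdot> Ev D = Ev D" using e(12) I V Comp_Ident_right[OF e(2)] by simp
    moreover have "Ew D \<cdot> e = Ew D"
      using e(13) I V Comp_Ident_left[OF e(3)] ShArr_Ident[OF ab(1)] by simp
    ultimately show ?thesis using unipotent_invertible[OF e(2,3,9) w] by blast
  qed
  note k' = triangle2_homD[OF k] and p' = triangle2_homD[OF p]
  obtain l r where "l \<in> Hom C (Vc A) (Vc A)" "r \<in> Hom C (Vc B) (Vc B)"
    "l \<cdot> (p \<cdot> k) = Ident C (Vc A)" "(k \<cdot> p) \<cdot> r = Ident C (Vc B)"
    using endo[OF triangle2_hom_Comp[OF k p] V(1,3) wA] endo[OF triangle2_hom_Comp[OF p k] V(2,4) wB] by blast
  then show ?thesis
    using invertible_of_composites[OF k'(9) p'(9)] arr_inverseI[OF k'(9)] by blast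
qed

end

section \<open>Distinguished two-triangles\<close>

context fully_triangulated begin

lemma DMap_is_map: "n \<ge> 2 \<Longrightarrow> G \<in> DMap n \<Longrightarrow> is_triangle_map C n G"
  and DMap_Src: "n \<ge> 2 \<Longrightarrow> G \<in> DMap n \<Longrightarrow> Src G \<in> DObj n"
  and DMap_Tgt: "n \<ge> 2 \<Longrightarrow> G \<in> DMap n \<Longrightarrow> Tgt G \<in> DObj n"
  and DObj_triangle: "n \<ge> 2 \<Longrightarrow> A \<in> DObj n \<Longrightarrow> is_triangle C n A"
  and DMap_Ident: "n \<ge> 2 \<Longrightarrow> A \<in> DObj n
      \<Longrightarrow> mk_triangle_map n A A (\<lambda>i j. Ident C (Vx A i j)) \<in> DMap n"
  and DMap_Comp: "n \<ge> 2 \<Longrightarrow> G \<in> DMap n \<Longrightarrow> H \<in> DMap n \<Longrightarrow> Tgt G = Src H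
      \<Longrightarrow> mk_triangle_map n (Src G) (Tgt H) (\<lambda>i j. Cmp H i j \<cdot> Cmp G i j) \<in> DMap n"
  using subcategory[of n] by (auto simp: is_subcategory_def triangle_category_def)

lemma DMap_2_triangle2_hom: "triangle2_map A B f g h \<in> DMap 2 \<Longrightarrow> triangle2_hom A B f g h"
  using DMap_is_map is_triangle_map_2 by blast

lemma DMap_2_DObj:
  "triangle2_map A B f g h \<in> DMap 2 \<Longrightarrow> A \<in> DObj 2"
  "triangle2_map A B f g h \<in> DMap 2 \<Longrightarrow> B \<in> DObj 2"
  using DMap_Src[of 2 "triangle2_map A B f g h"] DMap_Tgt[of 2 "triangle2_map A B f g h"]
  by (simp_all add: triangle2_map_sel)

lemma DMap_2_Comp:
  assumes "triangle2_map A B f g h \<in> DMap 2" "triangle2_map B D f' g' h' \<in> DMap 2"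
  shows "triangle2_map A D (f' \<cdot> f) (g' \<cdot> g) (h' \<cdot> h) \<in> DMap 2"
  using DMap_Comp[OF order.refl assms]
  by (simp add: triangle2_map_sel mk_triangle_map_2 del: One_nat_def)

text \<open>This \<open>0 \<rightarrow> x \<rightarrow> x \<rightarrow> 0\<close> is a face of a degenerate 3-triangle: repeat the index \<open>0\<close> of a
  2-triangle with first object \<open>x\<close>, so that \<open>a\<^sub>0\<^sub>1 = 0\<close> and \<open>a\<^sub>0\<^sub>2 = a\<^sub>1\<^sub>2 = x\<close>, and discard the index
  \<open>3\<close>.  Since faces and degeneracies are given on maps, they are applied to an identity.\<close>

lemma zero_triangle_distinguished:
  assumes x: "x \<in> Obj C"
  shows "triangle2 (ZeroOb C) x x (Zero C (ZeroOb C) x) (Ident C x)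
           (Zero C x (ShObj C (ZeroOb C))) \<in> DObj 2"
proof -
  let ?S = "mk_simplex 2 (\<lambda>_. x) (\<lambda>_ _. Ident C x)"
  have "is_simplex C 2 ?S"
    using Ident_Hom[OF x] by (simp add: is_simplex_2)
  then obtain A where A: "A \<in> DObj 2" "base 2 A = ?S" using base_exists[of 2 ?S] by blast
  have "SVx (base 2 A) 1 = x" using A by (simp add: mk_simplex_def)
  then have Ax: "Vx A 0 (Suc 0) = x" by (simp add: base_def mk_simplex_def)
  let ?I = "mk_triangle_map 2 A A (\<lambda>i j. Ident C (Vx A i j))"
  have "face_map 3 3 (degen_map C 3 0 ?I) \<in> DMap 2"
    using faces[of 3 3 "degen_map C 3 0 ?I"] degeneracies[of 3 0 ?I] DMap_Ident[OF _ A(1)] by simp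
  then have "Src (face_map 3 3 (degen_map C 3 0 ?I)) \<in> DObj 2" using DMap_Src by blast
  then have "face 3 3 (degen C 3 0 A) \<in> DObj 2"
    by (simp add: face_map_def degen_map_def mk_triangle_map_def Let_def)
  moreover have "face 3 3 (degen C 3 0 A)
      = triangle2 (ZeroOb C) x x (Zero C (ZeroOb C) x) (Ident C x) (Zero C x (ShObj C (ZeroOb C)))"
    by (simp add: face_def Let_def mk_triangle_2)
      (simp add: degen_def Let_def mk_triangle_def restr2_def restr3_def skip_def hit_twice_def Ax)
  ultimately show ?thesis by simp
qed

lemma DObj_2_extend:
  assumes A: "A \<in> DObj 2" and B: "B \<in> DObj 2"
    and f: "f \<in> Hom C (Va A) (Va B)" and g: "g \<in> Hom C (Vb A) (Vb B)" and sq: "g \<cdot> Eu A = Eu B \<cdot> f"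
  obtains h where "triangle2_map A B f g h \<in> DMap 2"
proof -
  have tA: "Eu A \<in> Hom C (Va A) (Vb A)" and tB: "Eu B \<in> Hom C (Va B) (Vb B)"
    by (rule is_triangle_2D[OF DObj_triangle[OF order.refl A]])
      (rule is_triangle_2D[OF DObj_triangle[OF order.refl B]])
  have range: "\<And>j. 1 \<le> j \<and> j \<le> 2 \<longleftrightarrow> j = 1 \<or> j = (2::nat)"
    "\<And>j k. 1 \<le> j \<and> j < k \<and> k \<le> 2 \<longleftrightarrow> j = 1 \<and> k = (2::nat)"
    "\<And>j k l. 1 \<le> j \<and> j < k \<and> k < l \<and> l \<le> (2::nat) \<longleftrightarrow> False" by auto
  have sel: "SVx (base 2 D) 1 = Va D" "SVx (base 2 D) 2 = Vb D" "SEdge (base 2 D) 1 2 = Eu D" for D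
    by (simp_all add: base_def mk_simplex_def Va_def Vb_def Eu_def)
  have simplex: "is_simplex C 2 (base 2 D)" if "Eu D \<in> Hom C (Va D) (Vb D)" for D
    using that by (simp add: base_def is_simplex_2 Va_def Vb_def Eu_def)
  have "is_simplex_map C 2 (base 2 A) (base 2 B) (\<lambda>j. if j = 1 then f else g)"
    unfolding is_simplex_map_def range
    using simplex[OF tA] simplex[OF tB] f g sq sel[of A] sel[of B] by (auto simp del: One_nat_def)
  then obtain G where "G \<in> DMap 2" "Src G = A" "Tgt G = B"
    "\<And>j. 1 \<le> j \<Longrightarrow> j \<le> 2 \<Longrightarrow> Cmp G 0 j = (if j = 1 then f else g)"
    using base_map_extends[OF order.refl A B] by blast
  then have G: "G \<in> DMap 2" "Src G = A" "Tgt G = B" "Cmp G 0 1 = f" "Cmp G 0 2 = g"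
    by (simp_all del: One_nat_def)
  then have "triangle2_map A B f g (Cmp G 1 2) \<in> DMap 2"
    using triangle_map_2_eq[OF DMap_is_map[OF order.refl G(1)]] G by (simp del: One_nat_def)
  then show ?thesis by (rule that)
qed

lemma DObj_2_exists:
  assumes u: "u \<in> Hom C a b"
  obtains A where "A \<in> DObj 2" "Va A = a" "Vb A = b" "Eu A = u"
proof -
  let ?S = "mk_simplex 2 (\<lambda>j. if j = 1 then a else b) (\<lambda>_ _. u)"
  have "is_simplex C 2 ?S"
    using u by (simp add: is_simplex_2)
  then obtain A where A: "A \<in> DObj 2" "base 2 A = ?S" using base_exists[of 2 ?S] by blast
  have "SVx (base 2 A) 1 = a" "SVx (base 2 A) 2 = b" "SEdge (base 2 A) 1 2 = u"
    using A by (simp_all add: mk_simplex_def)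
  then have "Va A = a" "Vb A = b" "Eu A = u"
    by (simp_all add: base_def mk_simplex_def Va_def Vb_def Eu_def)
  then show ?thesis using that A by blast
qed

text \<open>If \<open>z : c \<rightarrow> x\<close> kills \<open>v\<close>, then \<open>(0, z)\<close> is a map from the base \<open>v\<close> of the rotation
  \<open>(v, w, -u[1])\<close> to the base of \<open>0 \<rightarrow> x \<rightarrow> x \<rightarrow> 0\<close>.  The third component \<open>y : a[1] \<rightarrow> x\<close> of an
  extension satisfies \<open>y w = z\<close>.\<close>

lemma DObj_2_weak_cokernel:
  assumes A: "A \<in> DObj 2"
  shows "weak_cokernel (Ev A) (Ew A)"
proof -
  have a: "Eu A \<in> Hom C (Va A) (Vb A)" "Ev A \<in> Hom C (Vb A) (Vc A)"
    "Ew A \<in> Hom C (Vc A) (ShObj C (Va A))" by (rule is_triangle_2D[OF DObj_triangle[OF order.refl A]])+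
  have tau: "Va (tau C 2 A) = Vb A" "Vb (tau C 2 A) = Vc A" "Vc (tau C 2 A) = ShObj C (Va A)"
    "Eu (tau C 2 A) = Ev A" "Ev (tau C 2 A) = Ew A"
    unfolding tau_def mk_triangle_2 triangle2_sel by (simp_all add: Va_def Vb_def Vc_def Ev_def Ew_def)
  show ?thesis
  proof (rule weak_cokernelI[OF a(2,3)])
    fix x z assume z: "z \<in> Hom C (Vc A) x" and zv: "z \<cdot> Ev A = Zero C (Vb A) x"
    have x: "x \<in> Obj C" and b: "Vb A \<in> Obj C" using Hom_Obj[OF z] Hom_Obj[OF a(1)] by blast+
    let ?X = "triangle2 (ZeroOb C) x x (Zero C (ZeroOb C) x) (Ident C x)
      (Zero C x (ShObj C (ZeroOb C)))"
    let ?o = "Zero C (Vb A) (ZeroOb C)"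
    have o: "?o \<in> Hom C (Vb A) (ZeroOb C)" by (rule Zero_Hom[OF b ZeroOb_Obj])
    have "Zero C (ZeroOb C) x \<cdot> ?o = Zero C (Vb A) x" by (rule Zero_Comp[OF o x])
    then obtain y where y: "triangle2_map (tau C 2 A) ?X ?o z y \<in> DMap 2"
      using DObj_2_extend[OF rotation_tau[OF _ A] zero_triangle_distinguished[OF x], of ?o z]
        o z zv by (auto simp: tau triangle2_sel)
    note m = triangle2_homD[OF DMap_2_triangle2_hom[OF y], unfolded tau triangle2_sel]
    show "\<exists>y \<in> Hom C (ShObj C (Va A)) x. z = y \<cdot> Ew A"
      using m(9) m(12) Comp_Ident_left[OF z] by metis
  qed
qed

text \<open>The criterion by which 2-triangles are shown to be distinguished: compare with a distinguished one
  on the same base.  The weak cokernel property stands in for the distinguishedness of \<open>A\<close>.\<close>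

lemma DObj_2_of_maps_over_Ident:
  assumes D: "D \<in> DObj 2" and A: "weak_cokernel (Ev A) (Ew A)"
    and V: "Va A = a" "Va D = a" "Vb A = b" "Vb D = b"
    and k: "triangle2_hom A D (Ident C a) (Ident C b) k" and p: "triangle2_hom D A (Ident C a) (Ident C b) p"
  shows "A \<in> DObj 2"
proof -
  obtain p' where p': "arr_inverse p p'"
    using triangle2_hom_over_Ident_invertible[OF p k V(2,1,4,3) DObj_2_weak_cokernel[OF D] A] by blast
  have "a \<in> Obj C" "b \<in> Obj C" using Hom_Obj[OF triangle2_homD(1)[OF k]] V by simp_all
  then show ?thesis
    using triangle2_hom_inverse(2)[OF p arr_inverse_Ident arr_inverse_Ident p'] iso_closed[of 2] D
    by (fastforce simp: triangle2_map_sel)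
qed

section \<open>Sums, summands and morphisms\<close>

text \<open>Compare \<open>S\<close> with a distinguished \<open>D\<close> on the base of \<open>S\<close>.  Extensions of the injections and
  projections on the bases add up to \<open>(1, 1, k) : S \<rightarrow> D\<close> and \<open>(1, 1, q) : D \<rightarrow> S\<close>, both of which
  are isomorphisms, so \<open>S\<close> is distinguished.  The injections of \<open>S\<close> are the chosen distinguished maps
  into \<open>D\<close> followed by the inverse of \<open>(1, 1, k)\<close>, and dually for the projections with \<open>q\<close>; one of
  each is what a shear of \<open>S\<close> has to be composed with to recover its off-diagonal entry.\<close>

theorem dsum_distinguished:
  assumes A: "A \<in> DObj 2" and B: "B \<in> DObj 2" and S: "triangle2_biproduct A B S P Q R"
  shows "S \<in> DObj 2"
    "triangle2_map A S (Inj1 P) (Inj1 Q) (Inj1 R) \<in> DMap 2"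
    "triangle2_map S B (Prj2 P) (Prj2 Q) (Prj2 R) \<in> DMap 2"
proof -
  note S' = triangle2_biproductD[OF S]
  note P = is_biproductD[OF S'(1)] and Q = is_biproductD[OF S'(2)] and R = is_biproductD[OF S'(3)]
  note i1 = triangle2_homD[OF S'(7)] and i2 = triangle2_homD[OF S'(8)]
  note p1 = triangle2_homD[OF S'(9)] and p2 = triangle2_homD[OF S'(10)]
  have wS: "weak_cokernel (Ev S) (Ew S)"
    by (rule weak_cokernel_dsum[OF S DObj_2_weak_cokernel[OF A] DObj_2_weak_cokernel[OF B]])
  have abS: "Va S \<in> Obj C" "Vb S \<in> Obj C" using Hom_Obj[OF i1(4)] by blast+
  obtain D where D: "D \<in> DObj 2" "Va D = Va S" "Vb D = Vb S" "Eu D = Eu S"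
    by (rule DObj_2_exists[OF i1(4)])
  obtain k1 where k1: "triangle2_map A D (Inj1 P) (Inj1 Q) k1 \<in> DMap 2"
    using DObj_2_extend[OF A D(1)] i1(7,8,11) D by metis
  obtain k2 where k2: "triangle2_map B D (Inj2 P) (Inj2 Q) k2 \<in> DMap 2"
    using DObj_2_extend[OF B D(1)] i2(7,8,11) D by metis
  obtain q1 where q1: "triangle2_map D A (Prj1 P) (Prj1 Q) q1 \<in> DMap 2"
    using DObj_2_extend[OF D(1) A] p1(7,8,11) D by metis
  obtain q2 where q2: "triangle2_map D B (Prj2 P) (Prj2 Q) q2 \<in> DMap 2"
    using DObj_2_extend[OF D(1) B] p2(7,8,11) D by metis
  note tk1 = DMap_2_triangle2_hom[OF k1] and tk2 = DMap_2_triangle2_hom[OF k2]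
    and tq1 = DMap_2_triangle2_hom[OF q1] and tq2 = DMap_2_triangle2_hom[OF q2]
  note hk1 = triangle2_homD(9)[OF tk1] and hk2 = triangle2_homD(9)[OF tk2]
    and hq1 = triangle2_homD(9)[OF tq1] and hq2 = triangle2_homD(9)[OF tq2]
  define k where "k = k1 \<cdot> Prj1 R \<boxplus> k2 \<cdot> Prj2 R"
  define q where "q = Inj1 R \<cdot> q1 \<boxplus> Inj2 R \<cdot> q2"
  have tk: "triangle2_hom S D (Ident C (Va S)) (Ident C (Vb S)) k"
    using triangle2_hom_Add[OF triangle2_hom_Comp[OF S'(9) tk1] triangle2_hom_Comp[OF S'(10) tk2]]
    by (simp add: k_def P Q S')
  have tq: "triangle2_hom D S (Ident C (Va S)) (Ident C (Vb S)) q"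
    using triangle2_hom_Add[OF triangle2_hom_Comp[OF tq1 S'(7)] triangle2_hom_Comp[OF tq2 S'(8)]]
    by (simp add: q_def P Q S')
  show SD: "S \<in> DObj 2"
    by (rule DObj_2_of_maps_over_Ident[OF D(1) wS _ D(2) _ D(3) tk tq]) simp_all
  note wD = DObj_2_weak_cokernel[OF D(1)]
  note I = arr_inverse_Ident[OF abS(1)] arr_inverse_Ident[OF abS(2)]
  obtain k' where k': "arr_inverse k k'"
    using triangle2_hom_over_Ident_invertible[OF tk tq refl D(2) refl D(3) wS wD] by blast
  obtain q' where q': "arr_inverse q q'"
    using triangle2_hom_over_Ident_invertible[OF tq tk D(2) refl D(3) refl wD wS] by blast
  note kk = arr_inverseD[OF k' triangle2_homD(9)[OF tk]] and qq = arr_inverseD[OF q' triangle2_homD(9)[OF tq]]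
  have swap: "arr_inverse k' k"
    using kk arr_inverseI[OF kk(1) triangle2_homD(9)[OF tk]] by blast
  have swapq: "arr_inverse q' q"
    using qq arr_inverseI[OF qq(1) triangle2_homD(9)[OF tq]] by blast
  have dk': "triangle2_map D S (Ident C (Va S)) (Ident C (Vb S)) k' \<in> DMap 2"
    using iso_map[OF _ triangle2_hom_inverse(2)[OF triangle2_hom_inverse(1)[OF tk I k'] I swap]] D SD
    by (simp add: triangle2_map_sel)
  have dq': "triangle2_map S D (Ident C (Va S)) (Ident C (Vb S)) q' \<in> DMap 2"
    using iso_map[OF _ triangle2_hom_inverse(2)[OF triangle2_hom_inverse(1)[OF tq I q'] I swapq]] D SD
    by (simp add: triangle2_map_sel)
  have "k \<cdot> Inj1 R = k1"
  proof -
    have "k \<cdot> Inj1 R = k1 \<cdot> Prj1 R \<cdot> Inj1 R \<boxplus> k2 \<cdot> Prj2 R \<cdot> Inj1 R"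
      unfolding k_def using Comp_Add_left[OF R(1) Comp_Hom[OF R(3) hk1] Comp_Hom[OF R(4) hk2]] .
    then show ?thesis
      using Comp_assoc[OF R(1) R(3) hk1] Comp_assoc[OF R(1) R(4) hk2] R Comp_Ident_right[OF hk1]
        Comp_Zero[OF hk2 R(10)] Add_Zero[OF hk1] by simp
  qed
  then have "k' \<cdot> k1 = Inj1 R"
    using Comp_assoc[OF i1(9) triangle2_homD(9)[OF tk] kk(1)] kk(2) Comp_Ident_left[OF i1(9)] by simp
  then show "triangle2_map A S (Inj1 P) (Inj1 Q) (Inj1 R) \<in> DMap 2"
    using DMap_2_Comp[OF k1 dk'] Comp_Ident_left[OF i1(7)] Comp_Ident_left[OF i1(8)] by simp
  have "Prj2 R \<cdot> q = q2"
  proof -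
    have "Prj2 R \<cdot> q = Prj2 R \<cdot> (Inj1 R \<cdot> q1) \<boxplus> Prj2 R \<cdot> (Inj2 R \<cdot> q2)"
      unfolding q_def using Comp_Add_right[OF Comp_Hom[OF hq1 R(1)] Comp_Hom[OF hq2 R(2)] R(4)] .
    then show ?thesis
      using Comp_assoc[OF hq1 R(1) R(4)] Comp_assoc[OF hq2 R(2) R(4)] R Comp_Ident_left[OF hq2]
        Zero_Comp[OF hq1 R(11)] Add_Zero[OF hq2] by simp
  qed
  then have "q2 \<cdot> q' = Prj2 R"
    using Comp_assoc[OF qq(1) triangle2_homD(9)[OF tq] p2(9)] qq(3) Comp_Ident_right[OF p2(9)] by simp
  then show "triangle2_map S B (Prj2 P) (Prj2 Q) (Prj2 R) \<in> DMap 2"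
    using DMap_2_Comp[OF dq' q2] Comp_Ident_right[OF p2(7)] Comp_Ident_right[OF p2(8)] by simp
qed

text \<open>Complete the base of \<open>A\<close> to a distinguished \<open>D\<close>.  On bases \<open>i\<close> and \<open>p\<close> are also maps between
  \<open>D\<close> and \<open>S\<close>; their extensions, composed with \<open>p\<close> and \<open>i\<close> themselves, compare \<open>A\<close> with \<open>D\<close>.\<close>

lemma retract_distinguished:
  assumes i: "triangle2_hom A S i\<^sub>a i\<^sub>b i\<^sub>c" and p: "triangle2_hom S A p\<^sub>a p\<^sub>b p\<^sub>c"
    and pi: "p\<^sub>a \<cdot> i\<^sub>a = Ident C (Va A)" "p\<^sub>b \<cdot> i\<^sub>b = Ident C (Vb A)" "p\<^sub>c \<cdot> i\<^sub>c = Ident C (Vc A)"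
    and S: "S \<in> DObj 2"
  shows "A \<in> DObj 2"
proof -
  note i' = triangle2_homD[OF i] and p' = triangle2_homD[OF p]
  obtain D where D: "D \<in> DObj 2" "Va D = Va A" "Vb D = Vb A" "Eu D = Eu A"
    by (rule DObj_2_exists[OF i'(1)])
  obtain k where k: "triangle2_map D S i\<^sub>a i\<^sub>b k \<in> DMap 2"
    using DObj_2_extend[OF D(1) S] i'(7,8,11) D by metis
  obtain q where q: "triangle2_map S D p\<^sub>a p\<^sub>b q \<in> DMap 2"
    using DObj_2_extend[OF S D(1)] p'(7,8,11) D by metis
  show ?thesis
    using DObj_2_of_maps_over_Ident[OF D(1) weak_cokernel_retract[OF i p pi(3) DObj_2_weak_cokernel[OF S]]
        refl D(2) refl D(3)]
      triangle2_hom_Comp[OF i DMap_2_triangle2_hom[OF q]] triangle2_hom_Comp[OF DMap_2_triangle2_hom[OF k] p] pi by simp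
qed

lemma triangle2_biproduct_exists:
  assumes A: "is_triangle C 2 A" and B: "is_triangle C 2 B"
  obtains S P Q R where "triangle2_biproduct A B S P Q R"
proof -
  have "Va A \<in> Obj C" "Vb A \<in> Obj C" "Vc A \<in> Obj C" "Va B \<in> Obj C" "Vb B \<in> Obj C" "Vc B \<in> Obj C"
    using is_triangle_2D[OF A] is_triangle_2D[OF B] Hom_Obj by blast+
  then obtain P Q R where "is_biproduct C (Va A) (Va B) P" "is_biproduct C (Vb A) (Vb B) Q"
    "is_biproduct C (Vc A) (Vc B) R" using biproduct_exists by meson
  then show ?thesis using that dsum_triangle_biproduct[OF A B] by blast
qed

text \<open>The shear of \<open>A \<oplus> B\<close> with entry \<open>(f, g, h)\<close> is an automorphism of a distinguished 2-triangle,
  hence distinguished by the isomorphism axiom, and \<open>(f, g, h)\<close> is the composite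
  \<open>A \<rightarrow> A \<oplus> B \<rightarrow> A \<oplus> B \<rightarrow> B\<close> of an injection, the shear and a projection.\<close>

theorem hom_distinguished:
  assumes A: "A \<in> DObj 2" and B: "B \<in> DObj 2" and m: "triangle2_hom A B f g h"
  shows "triangle2_map A B f g h \<in> DMap 2"
proof -
  note m' = triangle2_homD[OF m]
  obtain S P Q R where S: "triangle2_biproduct A B S P Q R" using triangle2_biproduct_exists[OF m'(14,15)] .
  note S' = triangle2_biproductD[OF S] and dS = dsum_distinguished[OF A B S]
  have "triangle2_hom S S (shear P f) (shear Q g) (shear R h)"
    unfolding shear_def
    using triangle2_hom_Add[OF triangle2_hom_Ident[OF triangle2_homD(15)[OF S'(7)]]
        triangle2_hom_Comp[OF S'(9) triangle2_hom_Comp[OF m S'(8)]]] S' by simp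
  moreover have "arr_inverse (shear P f) (shear P (Neg C f))"
    "arr_inverse (shear Q g) (shear Q (Neg C g))" "arr_inverse (shear R h) (shear R (Neg C h))"
    using arr_inverseI shear_Hom shear_inverse S'(1-3) m'(7-9) Neg_Hom by meson+
  ultimately have "triangle2_map S S (shear P f) (shear Q g) (shear R h) \<in> DMap 2"
    using iso_map[of 2] triangle2_hom_inverse(2) dS(1) by (simp add: triangle2_map_sel)
  from DMap_2_Comp[OF dS(2) DMap_2_Comp[OF this dS(3)]]
  show ?thesis using shear_entry[OF S'(1) m'(7)] shear_entry[OF S'(2) m'(8)] shear_entry[OF S'(3) m'(9)]
    by simp
qed

theorem DMap_2_iff:
  "triangle2_map A B f g h \<in> DMap 2 \<longleftrightarrow> A \<in> DObj 2 \<and> B \<in> DObj 2 \<and> triangle2_hom A B f g h"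
  using hom_distinguished DMap_2_triangle2_hom DMap_2_DObj by blast

theorem dsum_distinguished_iff:
  assumes S: "triangle2_biproduct A B S P Q R"
  shows "S \<in> DObj 2 \<longleftrightarrow> A \<in> DObj 2 \<and> B \<in> DObj 2"
proof -
  note S' = triangle2_biproductD[OF S]
  note P = is_biproductD[OF S'(1)] and Q = is_biproductD[OF S'(2)] and R = is_biproductD[OF S'(3)]
  show ?thesis
    using dsum_distinguished(1)[OF _ _ S] retract_distinguished[OF S'(7,9) P(5) Q(5) R(5)]
      retract_distinguished[OF S'(8,10) P(6) Q(6) R(6)] by blast
qed

end

theorem theorem4p1:
  fixes C :: "('o, 'm, 'x) shift_category_scheme"
    and DObj :: "nat \<Rightarrow> ('o, 'm) triangle set"
    and DMap :: "nat \<Rightarrow> ('o, 'm) triangle_map set"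
    and a b c a' b' c' :: "nat \<Rightarrow> 'o"
    and u v w u' v' w' f g h :: "nat \<Rightarrow> 'm"
    and T T' :: "nat \<Rightarrow> ('o, 'm) triangle"
    and G :: "nat \<Rightarrow> ('o, 'm) triangle_map"
    and PA PB PC PA' PB' PC' :: "('o, 'm) biproduct"
  defines "T \<equiv> \<lambda>i. triangle2 (a i) (b i) (c i) (u i) (v i) (w i)"
    and "T' \<equiv> \<lambda>i. triangle2 (a' i) (b' i) (c' i) (u' i) (v' i) (w' i)"
    and "G \<equiv> \<lambda>i. triangle2_map (T i) (T' i) (f i) (g i) (h i)"
  assumes "fully_triangulated C DObj DMap"
    and "\<And>i. i \<in> {1, 2} \<Longrightarrow> G i \<in> Hom (triangle_category C 2) (T i) (T' i)"
    and "is_biproduct C (a 1) (a 2) PA" "is_biproduct C (a' 1) (a' 2) PA'"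
    and "is_biproduct C (b 1) (b 2) PB" "is_biproduct C (b' 1) (b' 2) PB'"
    and "is_biproduct C (c 1) (c 2) PC" "is_biproduct C (c' 1) (c' 2) PC'"
  shows "(G 1 \<in> DMap 2 \<and> G 2 \<in> DMap 2) \<longleftrightarrow>
    triangle2_map
      (triangle2 (Apex PA) (Apex PB) (Apex PC)
        (dsum_arr C PA PB (u 1) (u 2))
        (dsum_arr C PB PC (v 1) (v 2))
        (dsum_arr C PC (shift_biproduct C PA) (w 1) (w 2)))
      (triangle2 (Apex PA') (Apex PB') (Apex PC')
        (dsum_arr C PA' PB' (u' 1) (u' 2))
        (dsum_arr C PB' PC' (v' 1) (v' 2))
        (dsum_arr C PC' (shift_biproduct C PA') (w' 1) (w' 2)))
      (dsum_arr C PA PA' (f 1) (f 2))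
      (dsum_arr C PB PB' (g 1) (g 2))
      (dsum_arr C PC PC' (h 1) (h 2))
    \<in> DMap 2"
proof -
  interpret fully_triangulated C DObj DMap by fact
  have m: "triangle2_hom (T i) (T' i) (f i) (g i) (h i)" if "i \<in> {1, 2}" for i
    using assms(5)[OF that]
    by (simp add: G_def Hom_def triangle_category_def is_triangle_map_2)
  have m1: "triangle2_hom (T 1) (T' 1) (f 1) (g 1) (h 1)" and m2: "triangle2_hom (T 2) (T' 2) (f 2) (g 2) (h 2)"
    by (rule m, simp)+
  have sel: "Va (T i) = a i" "Vb (T i) = b i" "Vc (T i) = c i"
    "Va (T' i) = a' i" "Vb (T' i) = b' i" "Vc (T' i) = c' i"
    "Eu (T i) = u i" "Ev (T i) = v i" "Ew (T i) = w i"
    "Eu (T' i) = u' i" "Ev (T' i) = v' i" "Ew (T' i) = w' i" for i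
    by (simp_all add: T_def T'_def triangle2_sel)
  let ?S = "dsum_triangle PA PB PC (T 1) (T 2)" and ?S' = "dsum_triangle PA' PB' PC' (T' 1) (T' 2)"
  have S: "triangle2_biproduct (T 1) (T 2) ?S PA PB PC"
    by (rule dsum_triangle_biproduct; (rule triangle2_homD[OF m1] triangle2_homD[OF m2])?; unfold sel; fact)
  have S': "triangle2_biproduct (T' 1) (T' 2) ?S' PA' PB' PC'"
    by (rule dsum_triangle_biproduct; (rule triangle2_homD[OF m1] triangle2_homD[OF m2])?; unfold sel; fact)
  have "G 1 \<in> DMap 2 \<and> G 2 \<in> DMap 2 \<longleftrightarrow>
      (T 1 \<in> DObj 2 \<and> T 2 \<in> DObj 2) \<and> (T' 1 \<in> DObj 2 \<and> T' 2 \<in> DObj 2)"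
    using m1 m2 unfolding G_def DMap_2_iff by blast
  also have "\<dots> \<longleftrightarrow> ?S \<in> DObj 2 \<and> ?S' \<in> DObj 2"
    unfolding dsum_distinguished_iff[OF S] dsum_distinguished_iff[OF S'] ..
  also have "\<dots> \<longleftrightarrow> triangle2_map ?S ?S' (dsum_arr C PA PA' (f 1) (f 2))
      (dsum_arr C PB PB' (g 1) (g 2)) (dsum_arr C PC PC' (h 1) (h 2)) \<in> DMap 2"
    unfolding DMap_2_iff using triangle2_hom_dsum[OF S S' m1 m2] by blast
  finally show ?thesis unfolding dsum_triangle_def sel .
qed

end
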